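(* Let $G$ and $H$ be split graphs. There exists a polynomial-time algorithm to compute the independence number $\alpha(G\times H)$.
   Context: A graph $G$ is a split graph if there is a partition $\{S,C\}$ of its vertex set such that $C$ induces a clique and $S$ induces an independent set. For graphs $G$ and $H$, the categorical (tensor) product $G \times H$ has vertex set $V(G)\times V(H)$, and $(g_1,h_1)$ is adjacent to $(g_2,h_2)$ iff $\{g_1,g_2\}\in E(G)$ and $\{h_1,h_2\}\in E(H)$. *)

theory Defs
  imports "Graph_Theory.Pair_Digraph" "HOL-Computational_Algebra.Polynomial"
begin

section \<open>Graphs\<close>

text \<open>
  Finite simple graphs are the values satisfying \<^const>\<open>pair_graph\<close>: finite, loop-free and
  symmetric, where an edge \<open>{u, v}\<close> is the pair of arcs \<open>(u, v)\<close>, \<open>(v, u)\<close>.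
\<close>

definition clique :: "'a pair_pre_digraph \<Rightarrow> 'a set \<Rightarrow> bool" where
  "clique G C \<longleftrightarrow> C \<subseteq> pverts G \<and> (\<forall>u\<in>C. \<forall>v\<in>C. u \<noteq> v \<longrightarrow> (u, v) \<in> parcs G)"

definition independent_set :: "'a pair_pre_digraph \<Rightarrow> 'a set \<Rightarrow> bool" where
  "independent_set G I \<longleftrightarrow> I \<subseteq> pverts G \<and> (\<forall>u\<in>I. \<forall>v\<in>I. (u, v) \<notin> parcs G)"

definition independence_number :: "'a pair_pre_digraph \<Rightarrow> nat" where
  "independence_number G = Max {card I | I. independent_set G I}"

text \<open>Either part may be empty, so complete and edgeless graphs are split.\<close>

definition split_graph :: "'a pair_pre_digraph \<Rightarrow> bool" where
  "split_graph G \<longleftrightarrow> pair_graph G \<and>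
     (\<exists>S C. S \<union> C = pverts G \<and> S \<inter> C = {} \<and> clique G C \<and> independent_set G S)"

definition tensor_product ::
  "'a pair_pre_digraph \<Rightarrow> 'b pair_pre_digraph \<Rightarrow> ('a \<times> 'b) pair_pre_digraph" where
  "tensor_product G H =
     \<lparr> pverts = pverts G \<times> pverts H,
       parcs = {((g1, h1), (g2, h2)) | g1 h1 g2 h2. (g1, g2) \<in> parcs G \<and> (h1, h2) \<in> parcs H} \<rparr>"


section \<open>Algorithms and their running time\<close>

text \<open>
  Algorithms are programs for a random access machine, written in structured form. The store has
  registers and arrays, both indexed by natural numbers and holding natural numbers; a program
  mentions only finitely many registers and arrays.

  The only arithmetic operations are addition and truncated subtraction. Values therefore have bit
  length linear in the number of executed steps plus the bit length of the initial values, and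
  polynomial time under the uniform cost measure below is polynomial time on Turing machines. (With
  unit-cost multiplication this would fail.) Charging one step for evaluating an expression of
  any size only changes the time by a constant factor depending on the program.
\<close>

datatype aexp =
    Num nat
  | Reg nat
  | Cell nat aexp
  | Add aexp aexp
  | Sub aexp aexp

datatype bexp =
    Le aexp aexp
  | Neg bexp
  | Conj bexp bexp

datatype com =
    Skip
  | Assign nat aexp
  | Store nat aexp aexp
  | Seq com com
  | Cond bexp com com
  | While bexp com

type_synonym state = "(nat \<Rightarrow> nat) \<times> (nat \<Rightarrow> nat \<Rightarrow> nat)"

fun aval :: "aexp \<Rightarrow> state \<Rightarrow> nat" where
  "aval (Num n) s = n"
| "aval (Reg x) s = fst s x"
| "aval (Cell a e) s = snd s a (aval e s)"
| "aval (Add e f) s = aval e s + aval f s"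
| "aval (Sub e f) s = aval e s - aval f s"

fun bval :: "bexp \<Rightarrow> state \<Rightarrow> bool" where
  "bval (Le e f) s \<longleftrightarrow> aval e s \<le> aval f s"
| "bval (Neg b) s \<longleftrightarrow> \<not> bval b s"
| "bval (Conj b c) s \<longleftrightarrow> bval b s \<and> bval c s"

text \<open>\<open>exec c s t s'\<close>: started in \<open>s\<close>, the program \<open>c\<close> halts in \<open>s'\<close> after \<open>t\<close> steps.\<close>

inductive exec :: "com \<Rightarrow> state \<Rightarrow> nat \<Rightarrow> state \<Rightarrow> bool" where
  Skip: "exec Skip s 1 s"
| Assign: "exec (Assign x e) (r, m) 1 (r(x := aval e (r, m)), m)"
| Store: "exec (Store a e f) (r, m) 1 (r, m(a := (m a)(aval e (r, m) := aval f (r, m))))"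
| Seq: "exec c s t s' \<Longrightarrow> exec d s' u s'' \<Longrightarrow> exec (Seq c d) s (t + u) s''"
| CondT: "bval b s \<Longrightarrow> exec c s t s' \<Longrightarrow> exec (Cond b c d) s (1 + t) s'"
| CondF: "\<not> bval b s \<Longrightarrow> exec d s t s' \<Longrightarrow> exec (Cond b c d) s (1 + t) s'"
| WhileF: "\<not> bval b s \<Longrightarrow> exec (While b c) s 1 s"
| WhileT: "bval b s \<Longrightarrow> exec c s t s' \<Longrightarrow> exec (While b c) s' u s'' \<Longrightarrow>
    exec (While b c) s (1 + t + u) s''"

inductive_cases exec_SkipE: "exec Skip s t s'"
inductive_cases exec_AssignE: "exec (Assign x e) s t s'"
inductive_cases exec_StoreE: "exec (Store a e f) s t s'"
inductive_cases exec_SeqE: "exec (Seq c d) s t s'"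
inductive_cases exec_CondE: "exec (Cond b c d) s t s'"
inductive_cases exec_WhileE: "exec (While b c) s t s'"

lemma exec_deterministic:
  "exec c s t s' \<Longrightarrow> exec c s u s'' \<Longrightarrow> t = u \<and> s' = s''"
proof (induction arbitrary: u s'' rule: exec.induct)
  case (Skip s)
  then show ?case by (auto elim: exec_SkipE)
next
  case (Assign x e r m)
  then show ?case by (auto elim: exec_AssignE)
next
  case (Store a e f r m)
  then show ?case by (auto elim: exec_StoreE)
next
  case (Seq c s t s' d u s'')
  from Seq.prems show ?case by (rule exec_SeqE) (use Seq.IH in metis)
next
  case (CondT b s c t s' d)
  from CondT.prems show ?case
    by (rule exec_CondE) (use CondT.hyps CondT.IH in \<open>metis plus_1_eq_Suc add_Suc One_nat_def\<close>)+
next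
  case (CondF b s d t s' c)
  from CondF.prems show ?case
    by (rule exec_CondE) (use CondF.hyps CondF.IH in \<open>metis plus_1_eq_Suc add_Suc One_nat_def\<close>)+
next
  case (WhileF b s c)
  from WhileF.prems show ?case
    by (rule exec_WhileE) (use WhileF.hyps in \<open>metis plus_1_eq_Suc add_Suc One_nat_def\<close>)+
next
  case (WhileT b s c t s' u s'')
  from WhileT.prems show ?case
    by (rule exec_WhileE) (use WhileT.hyps WhileT.IH in \<open>metis plus_1_eq_Suc add_Suc One_nat_def\<close>)+
qed

text \<open>The input is a bit string in array 0 with its length in register 0; everything else is 0.\<close>

definition init_state :: "bool list \<Rightarrow> state" where
  "init_state w =
     ((\<lambda>_. 0)(0 := length w),
      (\<lambda>_ _. 0)(0 := (\<lambda>i. if i < length w \<and> w ! i then 1 else 0)))"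

text \<open>The output is the final content of register 0.\<close>

definition computes_within :: "com \<Rightarrow> bool list \<Rightarrow> nat \<Rightarrow> nat \<Rightarrow> bool" where
  "computes_within c w k y \<longleftrightarrow>
     (\<exists>t r m. exec c (init_state w) t (r, m) \<and> t \<le> k \<and> r 0 = y)"

definition poly_time_computable ::
  "'i set \<Rightarrow> ('i \<Rightarrow> bool list) \<Rightarrow> ('i \<Rightarrow> nat) \<Rightarrow> bool" where
  "poly_time_computable X enc f \<longleftrightarrow>
     (\<exists>c. \<exists>p :: nat poly. \<forall>x\<in>X. computes_within c (enc x) (poly p (length (enc x))) (f x))"


section \<open>Graphs as inputs\<close>

text \<open>
  To present a graph to a machine its vertices have to be listed in some order. The code of the
  graph is the number of vertices in unary, terminated by a zero bit, followed by the rows of the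
  adjacency matrix with respect to that order.
\<close>

definition vertex_listing :: "'a pair_pre_digraph \<Rightarrow> 'a list \<Rightarrow> bool" where
  "vertex_listing G vs \<longleftrightarrow> distinct vs \<and> set vs = pverts G"

definition encode_graph :: "'a pair_pre_digraph \<Rightarrow> 'a list \<Rightarrow> bool list" where
  "encode_graph G vs =
     replicate (length vs) True @ [False] @ concat (map (\<lambda>u. map (\<lambda>v. (u, v) \<in> parcs G) vs) vs)"

end

theory Submission
  imports Defs
begin

text \<open>
  Let \<open>C\<close>, \<open>S\<close> be the clique and the independent side of \<open>G\<close>, and \<open>C'\<close>, \<open>S'\<close> those of \<open>H\<close>. An
  independent set \<open>I\<close> of the product meets \<open>C \<times> C'\<close> inside one row or one column. If it contains two
  cells of the row of \<open>c\<close>, then it avoids every vertex of \<open>S \<times> C'\<close> having a neighbour in that row;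
  so with \<open>X\<close> a single cell, the whole row, or nothing, \<open>I\<close> lies in the union of \<open>X\<close> with the
  non-neighbours of \<open>X\<close> in \<open>S \<times> C'\<close> and of \<open>(C \<union> S) \<times> S'\<close>. Both parts are independent, so this
  induces a bipartite graph. Columns are symmetric, and the independence number of the product is
  the maximum over polynomially many bipartite graphs.

  For these, an auction computes a maximum matching: an unmatched left vertex takes over a cheapest
  neighbour and raises its price by one, until all neighbours of every unmatched left vertex have
  reached a price above the number of right vertices. A price that no right vertex attains then
  yields a vertex cover of the size of the matching, so the auction needs no augmenting paths.

  The sides of a split graph are read off the degrees: a vertex belongs to the clique iff it is
  adjacent to all vertices preceding it in decreasing order of degree.
\<close>

section \<open>Programs with loops bounded by the input length\<close>

text \<open>
  Every loop runs over \<open>0, \<dots>, N - 1\<close> for a fixed \<open>N\<close>, later the input length. The running time is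
  therefore a polynomial in \<open>N\<close> read off the program text, and only functional correctness remains.
\<close>

datatype hexp =
    HNum nat
  | HReg nat
  | HCell nat hexp
  | HAdd hexp hexp
  | HSub hexp hexp
  | HLe hexp hexp
  | HIf hexp hexp hexp
  | HSum nat hexp

datatype hcom =
    HAssign nat hexp
  | HStore nat hexp hexp
  | HSeq hcom hcom
  | HWhen hexp hcom
  | HFor nat hcom

fun heval :: "nat \<Rightarrow> hexp \<Rightarrow> state \<Rightarrow> nat" where
  "heval N (HNum n) s = n"
| "heval N (HReg x) s = fst s x"
| "heval N (HCell a e) s = snd s a (heval N e s)"
| "heval N (HAdd e f) s = heval N e s + heval N f s"
| "heval N (HSub e f) s = heval N e s - heval N f s"
| "heval N (HLe e f) s = (if heval N e s \<le> heval N f s then 1 else 0)"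
| "heval N (HIf b e f) s = (if heval N b s \<noteq> 0 then heval N e s else heval N f s)"
| "heval N (HSum x e) s = (\<Sum>i<N. heval N e ((fst s)(x := i), snd s))"

text \<open>\<open>HFor\<close> resets its register on exit, so that the value left behind does not
  depend on \<open>N\<close> and the final state of a loop has a closed form.\<close>

fun hrun :: "nat \<Rightarrow> hcom \<Rightarrow> state \<Rightarrow> state" where
  "hrun N (HAssign x e) s = ((fst s)(x := heval N e s), snd s)"
| "hrun N (HStore a e f) s =
     (fst s, (snd s)(a := (snd s a)(heval N e s := heval N f s)))"
| "hrun N (HSeq c d) s = hrun N d (hrun N c s)"
| "hrun N (HWhen e c) s = (if heval N e s \<noteq> 0 then hrun N c s else s)"
| "hrun N (HFor x c) s =
     (let s' = fold (\<lambda>i s. hrun N c ((fst s)(x := i), snd s)) [0..<N] s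
      in ((fst s')(x := 0), snd s'))"

fun regs_below :: "nat \<Rightarrow> hexp \<Rightarrow> bool" where
  "regs_below B (HNum n) \<longleftrightarrow> True"
| "regs_below B (HReg x) \<longleftrightarrow> x < B"
| "regs_below B (HCell a e) \<longleftrightarrow> regs_below B e"
| "regs_below B (HAdd e f) \<longleftrightarrow> regs_below B e \<and> regs_below B f"
| "regs_below B (HSub e f) \<longleftrightarrow> regs_below B e \<and> regs_below B f"
| "regs_below B (HLe e f) \<longleftrightarrow> regs_below B e \<and> regs_below B f"
| "regs_below B (HIf b e f) \<longleftrightarrow> regs_below B b \<and> regs_below B e \<and> regs_below B f"
| "regs_below B (HSum x e) \<longleftrightarrow> x < B \<and> regs_below B e"

fun cregs_below :: "nat \<Rightarrow> hcom \<Rightarrow> bool" where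
  "cregs_below B (HAssign x e) \<longleftrightarrow> x < B \<and> regs_below B e"
| "cregs_below B (HStore a e f) \<longleftrightarrow> regs_below B e \<and> regs_below B f"
| "cregs_below B (HSeq c d) \<longleftrightarrow> cregs_below B c \<and> cregs_below B d"
| "cregs_below B (HWhen e c) \<longleftrightarrow> regs_below B e \<and> cregs_below B c"
| "cregs_below B (HFor x c) \<longleftrightarrow> x < B \<and> cregs_below B c"

fun arrays :: "hexp \<Rightarrow> nat set" where
  "arrays (HNum n) = {}"
| "arrays (HReg x) = {}"
| "arrays (HCell a e) = insert a (arrays e)"
| "arrays (HAdd e f) = arrays e \<union> arrays f"
| "arrays (HSub e f) = arrays e \<union> arrays f"
| "arrays (HLe e f) = arrays e \<union> arrays f"
| "arrays (HIf b e f) = arrays b \<union> arrays e \<union> arrays f"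
| "arrays (HSum x e) = arrays e"

lemma heval_upd_array: "a \<notin> arrays e \<Longrightarrow> heval N e (r, m(a := f)) = heval N e (r, m)"
  by (induction e arbitrary: r) auto

text \<open>Scratch registers lie above \<open>B\<close>; this lets an expression be evaluated in a
  machine state that agrees with the abstract state only below \<open>B\<close>.\<close>

lemma heval_cong_regs:
  "regs_below B e \<Longrightarrow> (\<And>j. j < B \<Longrightarrow> r j = r' j) \<Longrightarrow> heval N e (r, m) = heval N e (r', m)"
proof (induction e arbitrary: r r')
  case (HSum x e)
  have "heval N e (r(x := i), m) = heval N e (r'(x := i), m)" for i
    by (rule HSum.IH) (use HSum.prems in auto)
  then show ?case by simp
next
  case (HCell a e)
  have "heval N e (r, m) = heval N e (r', m)" by (rule HCell.IH) (use HCell.prems in auto)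
  then show ?case by simp
next
  case (HAdd e f)
  have "heval N e (r, m) = heval N e (r', m)" "heval N f (r, m) = heval N f (r', m)"
    by (rule HAdd.IH; use HAdd.prems in auto)+
  then show ?case by simp
next
  case (HSub e f)
  have "heval N e (r, m) = heval N e (r', m)" "heval N f (r, m) = heval N f (r', m)"
    by (rule HSub.IH; use HSub.prems in auto)+
  then show ?case by simp
next
  case (HLe e f)
  have "heval N e (r, m) = heval N e (r', m)" "heval N f (r, m) = heval N f (r', m)"
    by (rule HLe.IH; use HLe.prems in auto)+
  then show ?case by simp
next
  case (HIf b e f)
  have "heval N b (r, m) = heval N b (r', m)" "heval N e (r, m) = heval N e (r', m)"
    "heval N f (r, m) = heval N f (r', m)"
    by (rule HIf.IH; use HIf.prems in auto)+
  then show ?case by simp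
qed auto

lemma heval_cong_state:
  assumes "regs_below B e" "\<And>j. j < B \<Longrightarrow> fst s' j = fst s j" "snd s' = snd s"
  shows "heval N e s' = heval N e s"
  using heval_cong_regs[OF assms(1), of "fst s'" "fst s" N "snd s"] assms by (cases s, cases s') simp

text \<open>
  Register \<open>B\<close> holds the loop bound and \<open>cexp B e k\<close> leaves the value of \<open>e\<close> in register \<open>k > B\<close>,
  the registers from \<open>k\<close> on being scratch space. The summation variable \<open>x\<close> is saved and restored.
\<close>

fun cexp :: "nat \<Rightarrow> hexp \<Rightarrow> nat \<Rightarrow> com" where
  "cexp B (HNum n) k = Assign k (Num n)"
| "cexp B (HReg x) k = Assign k (Reg x)"
| "cexp B (HCell a e) k = Seq (cexp B e k) (Assign k (Cell a (Reg k)))"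
| "cexp B (HAdd e f) k =
     Seq (cexp B e k) (Seq (cexp B f (k + 1)) (Assign k (Add (Reg k) (Reg (k + 1)))))"
| "cexp B (HSub e f) k =
     Seq (cexp B e k) (Seq (cexp B f (k + 1)) (Assign k (Sub (Reg k) (Reg (k + 1)))))"
| "cexp B (HLe e f) k =
     Seq (cexp B e k) (Seq (cexp B f (k + 1))
       (Cond (Le (Reg k) (Reg (k + 1))) (Assign k (Num 1)) (Assign k (Num 0))))"
| "cexp B (HIf b e f) k =
     Seq (cexp B b k) (Cond (Le (Num 1) (Reg k)) (cexp B e k) (cexp B f k))"
| "cexp B (HSum x e) k =
     Seq (Assign (k + 2) (Reg x)) (Seq (Assign k (Num 0)) (Seq (Assign (k + 1) (Num 0))
       (Seq (While (Neg (Le (Reg B) (Reg (k + 1))))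
         (Seq (Assign x (Reg (k + 1))) (Seq (cexp B e (k + 3))
           (Seq (Assign k (Add (Reg k) (Reg (k + 3))))
             (Assign (k + 1) (Add (Reg (k + 1)) (Num 1)))))))
         (Assign x (Reg (k + 2))))))"

text \<open>The counter of \<open>HFor\<close> is the scratch register \<open>k\<close>, copied into
  \<open>x\<close> before each pass and protected by compiling the body from \<open>k + 1\<close>
  on. A body that assigns \<open>x\<close> cannot change the number of passes.\<close>

fun ccom :: "nat \<Rightarrow> hcom \<Rightarrow> nat \<Rightarrow> com" where
  "ccom B (HAssign x e) k = Seq (cexp B e k) (Assign x (Reg k))"
| "ccom B (HStore a e f) k =
     Seq (cexp B e k) (Seq (cexp B f (k + 1)) (Store a (Reg k) (Reg (k + 1))))"
| "ccom B (HSeq c d) k = Seq (ccom B c k) (ccom B d k)"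
| "ccom B (HWhen e c) k = Seq (cexp B e k) (Cond (Le (Num 1) (Reg k)) (ccom B c k) Skip)"
| "ccom B (HFor x c) k =
     Seq (Assign k (Num 0))
       (Seq (While (Neg (Le (Reg B) (Reg k)))
         (Seq (Assign x (Reg k)) (Seq (ccom B c (k + 1)) (Assign k (Add (Reg k) (Num 1))))))
         (Assign x (Num 0)))"

text \<open>Upper bounds, not exact times: \<open>HIf\<close> is charged for both branches. The sums
  are bracketed as the rules for \<open>runs\<close> generate them.\<close>

fun texp :: "hexp \<Rightarrow> nat \<Rightarrow> nat" where
  "texp (HNum n) N = 1"
| "texp (HReg x) N = 1"
| "texp (HCell a e) N = texp e N + 1"
| "texp (HAdd e f) N = texp e N + (texp f N + 1)"
| "texp (HSub e f) N = texp e N + (texp f N + 1)"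
| "texp (HLe e f) N = texp e N + (texp f N + (1 + 1))"
| "texp (HIf b e f) N = texp b N + (1 + (texp e N + texp f N))"
| "texp (HSum x e) N = 1 + (1 + (1 + ((N * (1 + (1 + (texp e N + (1 + 1)))) + 1) + 1)))"

fun tcom :: "hcom \<Rightarrow> nat \<Rightarrow> nat" where
  "tcom (HAssign x e) N = texp e N + 1"
| "tcom (HStore a e f) N = texp e N + (texp f N + 1)"
| "tcom (HSeq c d) N = tcom c N + tcom d N"
| "tcom (HWhen e c) N = texp e N + (1 + (tcom c N + 1))"
| "tcom (HFor x c) N = 1 + ((N * (1 + (1 + (tcom c N + 1))) + 1) + 1)"

section \<open>Polynomial time bounds\<close>

lemma poly_time_intros:
  fixes f g :: "nat \<Rightarrow> nat"
  shows "\<exists>p. \<forall>n::nat. c = poly p n"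
    and "\<exists>p. \<forall>n::nat. n = poly p n"
    and "\<exists>p. \<forall>n. f n = poly p n \<Longrightarrow> \<exists>p. \<forall>n. g n = poly p n \<Longrightarrow> \<exists>p. \<forall>n. f n + g n = poly p n"
    and "\<exists>p. \<forall>n. f n = poly p n \<Longrightarrow> \<exists>p. \<forall>n. g n = poly p n \<Longrightarrow> \<exists>p. \<forall>n. f n * g n = poly p n"
proof -
  show "\<exists>p. \<forall>n::nat. c = poly p n" by (rule exI[of _ "[:c:]"]) simp
  show "\<exists>p. \<forall>n::nat. n = poly p n" by (rule exI[of _ "[:0, 1:]"]) simp
qed (metis poly_add, metis poly_mult)

lemma texp_poly: "\<exists>p. \<forall>N. texp e N = poly p N"
  by (induction e) (simp_all only: texp.simps, (intro poly_time_intros; assumption)+)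

lemma tcom_poly: "\<exists>p. \<forall>N. tcom c N = poly p N"
  by (induction c) (simp_all only: tcom.simps, (intro poly_time_intros texp_poly; assumption)+)

text \<open>A total-correctness judgement with a time bound. The postcondition is an arbitrary
  predicate, so \<open>runs_Seq\<close> can nest the judgement for the second program in it.\<close>

definition runs :: "com \<Rightarrow> nat \<Rightarrow> state \<Rightarrow> (state \<Rightarrow> bool) \<Rightarrow> bool" where
  "runs c T s Q \<longleftrightarrow> (\<exists>t s'. exec c s t s' \<and> t \<le> T \<and> Q s')"

lemma runs_mono: "runs c T s Q \<Longrightarrow> (\<And>s'. Q s' \<Longrightarrow> Q' s') \<Longrightarrow> T \<le> T' \<Longrightarrow> runs c T' s Q'"
  unfolding runs_def by (meson le_trans)

lemma runs_Skip: "Q s \<Longrightarrow> runs Skip 1 s Q"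
  unfolding runs_def using exec.Skip by blast

lemma runs_Assign: "Q ((fst s)(x := aval e s), snd s) \<Longrightarrow> runs (Assign x e) 1 s Q"
  unfolding runs_def using exec.Assign[of x e "fst s" "snd s"] by auto

lemma runs_Store:
  "Q (fst s, (snd s)(a := (snd s a)(aval e s := aval f s))) \<Longrightarrow> runs (Store a e f) 1 s Q"
  unfolding runs_def using exec.Store[of a e f "fst s" "snd s"] by auto

lemma runs_Seq: "runs c T s (\<lambda>s'. runs d U s' Q) \<Longrightarrow> runs (Seq c d) (T + U) s Q"
  unfolding runs_def using exec.Seq by (meson add_mono)

lemma runs_SeqI:
  "runs c T s P \<Longrightarrow> (\<And>s'. P s' \<Longrightarrow> runs d U s' Q) \<Longrightarrow> runs (Seq c d) (T + U) s Q"
  by (rule runs_Seq, rule runs_mono[of c T s P]) auto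

lemma runs_Cond:
  assumes "bval b s \<Longrightarrow> runs c T s Q" "\<not> bval b s \<Longrightarrow> runs d T s Q"
  shows "runs (Cond b c d) (1 + T) s Q"
  using assms exec.CondT[of b s c _ _ d] exec.CondF[of b s d _ _ c]
  unfolding runs_def by (meson add_le_cancel_left)

text \<open>The invariant fixes the counter, hence the guard, so there are exactly \<open>N\<close>
  passes of cost \<open>1 + T\<close> and one final failing test.\<close>

lemma runs_While_count:
  assumes body: "\<And>i s. i < N \<Longrightarrow> I i s \<Longrightarrow> runs c T s (I (Suc i))"
    and guard: "\<And>i s. I i s \<Longrightarrow> bval b s \<longleftrightarrow> i < N"
    and "I 0 s" and Q: "\<And>s. I N s \<Longrightarrow> Q s"
  shows "runs (While b c) (N * (1 + T) + 1) s Q"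
proof -
  \<comment> \<open>Induction on the number \<open>k\<close> of passes still to come.\<close>
  have "runs (While b c) (k * (1 + T) + 1) s Q" if "i + k = N" "I i s" for i k s
    using that
  proof (induction k arbitrary: i s)
    case 0
    then have "\<not> bval b s" "Q s" using guard[OF 0(2)] Q by auto
    then show ?case unfolding runs_def using exec.WhileF[of b s c] by (intro exI[of _ 1] exI[of _ s]) simp
  next
    case (Suc k)
    then have "i < N" by simp
    with body Suc.prems obtain t s' where 1: "exec c s t s'" "t \<le> T" "I (Suc i) s'"
      unfolding runs_def by blast
    with Suc.IH[of "Suc i" s'] Suc.prems obtain u s''
      where 2: "exec (While b c) s' u s''" "u \<le> k * (1 + T) + 1" "Q s''"
      unfolding runs_def by auto
    show ?case
      unfolding runs_def
      using exec.WhileT[OF _ 1(1) 2(1)] guard[OF Suc.prems(2)] \<open>i < N\<close> 1 2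
      by (intro exI[of _ "1 + t + u"] exI[of _ s'']) auto
  qed
  from this[of 0 N] \<open>I 0 s\<close> show ?thesis by simp
qed

text \<open>Preserving all registers below \<open>k\<close> is part of the claim, since the first
  operand waits in \<open>k\<close> while the second is computed from \<open>k + 1\<close>
  on.\<close>

lemma runs_cexp:
  assumes "regs_below B e" "B < k" "fst s B = N"
  shows "runs (cexp B e k) (texp e N) s
    (\<lambda>s'. snd s' = snd s \<and> fst s' k = heval N e s \<and> (\<forall>j<k. fst s' j = fst s j))"
  using assms
proof (induction e arbitrary: k s)
  case (HNum n)
  show ?case by (auto intro!: runs_Assign[unfolded One_nat_def])
next
  case (HReg x)
  show ?case by (auto intro!: runs_Assign[unfolded One_nat_def])
next
  case (HCell a e)
  show ?case unfolding cexp.simps texp.simps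
    by (rule runs_Seq, rule runs_mono[OF HCell.IH[of k s]]) (use HCell.prems in \<open>auto intro!: runs_Assign[unfolded One_nat_def]\<close>)
next
  case (HAdd e f)
  have *: "heval N f s' = heval N f s" if "snd s' = snd s" "\<forall>j<k. fst s' j = fst s j" for s'
    by (rule heval_cong_state) (use that HAdd.prems in auto)
  show ?case unfolding cexp.simps texp.simps
    apply (rule runs_SeqI[OF HAdd.IH(1)[of k s]])
    using HAdd.prems apply auto[3]
    apply (rule runs_SeqI[OF HAdd.IH(2)[of "k + 1"]])
    using HAdd.prems apply auto[3]
    subgoal for s'
      using *[of s'] HAdd.prems by (intro runs_Assign) auto
    done
next
  case (HSub e f)
  have *: "heval N f s' = heval N f s" if "snd s' = snd s" "\<forall>j<k. fst s' j = fst s j" for s'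
    by (rule heval_cong_state) (use that HSub.prems in auto)
  show ?case unfolding cexp.simps texp.simps
    apply (rule runs_SeqI[OF HSub.IH(1)[of k s]])
    using HSub.prems apply auto[3]
    apply (rule runs_SeqI[OF HSub.IH(2)[of "k + 1"]])
    using HSub.prems apply auto[3]
    subgoal for s'
      using *[of s'] HSub.prems by (intro runs_Assign) auto
    done
next
  case (HLe e f)
  have *: "heval N f s' = heval N f s" if "snd s' = snd s" "\<forall>j<k. fst s' j = fst s j" for s'
    by (rule heval_cong_state) (use that HLe.prems in auto)
  show ?case unfolding cexp.simps texp.simps
    apply (rule runs_SeqI[OF HLe.IH(1)[of k s]])
    using HLe.prems apply auto[3]
    apply (rule runs_SeqI[OF HLe.IH(2)[of "k + 1"]])
    using HLe.prems apply auto[3]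
    subgoal for s'
      using *[of s'] HLe.prems by (intro runs_Cond runs_Assign) auto
    done
next
  case (HIf b e f)
  have *: "heval N e s' = heval N e s" "heval N f s' = heval N f s"
    if "snd s' = snd s" "\<forall>j<k. fst s' j = fst s j" for s'
    by (rule heval_cong_state[of B]; use that HIf.prems in auto)+
  show ?case unfolding cexp.simps texp.simps
    apply (rule runs_SeqI[OF HIf.IH(1)[of k s]])
    using HIf.prems apply auto[3]
    apply (rule runs_Cond)
    subgoal for s' using *(1)[of s'] HIf.prems by (intro runs_mono[OF HIf.IH(2)[of k s']]) auto
    subgoal for s' using *(2)[of s'] HIf.prems by (intro runs_mono[OF HIf.IH(3)[of k s']]) auto
    done
next
  case (HSum x e)
  note [simp] = HSum.prems(3)
  from HSum.prems have x: "x < B" "B < k" "x < k" and e: "regs_below B e" by auto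
  \<comment> \<open>Register \<open>x\<close> is exempt from the frame condition because it holds
    the summation index during the loop; its old value is kept in \<open>k + 2\<close>.\<close>
  define I where "I i s' \<longleftrightarrow> snd s' = snd s \<and> fst s' k = (\<Sum>l<i. heval N e ((fst s)(x := l), snd s))
     \<and> fst s' (k + 1) = i \<and> fst s' (k + 2) = fst s x \<and> (\<forall>j<k. j \<noteq> x \<longrightarrow> fst s' j = fst s j)
     \<and> i \<le> N" for i and s' :: state
  show ?case unfolding cexp.simps texp.simps
    apply (rule runs_Seq, rule runs_Assign)+
    apply (rule runs_Seq)
    apply (rule runs_While_count[where I = I])
    subgoal for i s'
      apply (rule runs_Seq, rule runs_Assign, rule runs_Seq)
      apply (rule runs_mono[OF HSum.IH])
      using e x apply (auto simp: I_def)[3]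
       apply (rule runs_Seq, rule runs_Assign, rule runs_Assign)
      using x heval_cong_regs[OF e, of "(fst s')(x := i)" "(fst s)(x := i)"] 
      by (auto simp: I_def)
    subgoal for i s' using x by (auto simp: I_def)
    subgoal using x by (auto simp: I_def)
    subgoal for s' by (rule runs_Assign) (use x in \<open>auto simp: I_def\<close>)
    done
qed

text \<open>\<open>z\<close> is the abstract state and \<open>s\<close> the machine state; they need
  to agree only below \<open>B\<close>, as scratch registers differ. The last conjunct protects the
  loop bound in \<open>B\<close> and the counters of enclosing loops.\<close>

lemma runs_ccom:
  assumes "cregs_below B c" "B < k" "fst s B = N" "\<And>j. j < B \<Longrightarrow> fst s j = fst z j" "snd s = snd z"
  shows "runs (ccom B c k) (tcom c N) s
    (\<lambda>s'. snd s' = snd (hrun N c z) \<and> (\<forall>j<B. fst s' j = fst (hrun N c z) j) \<and>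
       (\<forall>j<k. B \<le> j \<longrightarrow> fst s' j = fst s j))"
  using assms
proof (induction c arbitrary: k s z)
  case (HAssign x e)
  have "heval N e s = heval N e z"
    by (rule heval_cong_state) (use HAssign.prems in auto)
  then show ?case unfolding ccom.simps tcom.simps
    by (intro runs_Seq, intro runs_mono[OF runs_cexp[of B e k s N]])
      (use HAssign.prems in \<open>auto intro!: runs_Assign[unfolded One_nat_def]\<close>)
next
  case (HStore a e f)
  have e: "heval N e s = heval N e z"
    by (rule heval_cong_state) (use HStore.prems in auto)
  have *: "heval N f s' = heval N f z" if "snd s' = snd s" "\<forall>j<k. fst s' j = fst s j" for s'
    by (rule heval_cong_state) (use that HStore.prems in auto)
  show ?case unfolding ccom.simps tcom.simps
    apply (rule runs_SeqI[OF runs_cexp[of B e k s N]])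
    using HStore.prems apply auto[3]
    apply (rule runs_SeqI[OF runs_cexp[of B f "k + 1" _ N]])
    using HStore.prems apply auto[3]
    subgoal for s'
      using *[of s'] e HStore.prems by (intro runs_Store) auto
    done
next
  case (HSeq c d)
  show ?case unfolding ccom.simps tcom.simps
    apply (rule runs_Seq)
    apply (rule runs_mono[OF HSeq.IH(1)[of k s z]])
    using HSeq.prems apply simp_all
    subgoal for s' 
      by (rule runs_mono[OF HSeq.IH(2)[of k s' "hrun N c z"]]) auto
    done
next
  case (HWhen e c)
  have e: "heval N e s = heval N e z"
    by (rule heval_cong_state) (use HWhen.prems in auto)
  show ?case unfolding ccom.simps tcom.simps
    apply (rule runs_SeqI[OF runs_cexp[of B e k s N]])
    using HWhen.prems apply auto[3]
    apply (rule runs_Cond)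
    subgoal for s' using e HWhen.prems by (intro runs_mono[OF HWhen.IH[of k s' z]]) auto
    subgoal for s' using e HWhen.prems by (intro runs_mono[OF runs_Skip[of _ s']]) auto
    done
next
  case (HFor x c)
  note [simp] = HFor.prems(3)
  from HFor.prems have x: "x < B" "B < k" "x < k" and c: "cregs_below B c" by auto
  \<comment> \<open>\<open>F i\<close> is the abstract state after \<open>i\<close> passes.\<close>
  define F where "F i = fold (\<lambda>i s. hrun N c ((fst s)(x := i), snd s)) [0..<i] z" for i
  have F0: "F 0 = z" and FSuc: "F (Suc i) = hrun N c ((fst (F i))(x := i), snd (F i))" for i
    by (simp_all add: F_def)
  define I where "I i s' \<longleftrightarrow> snd s' = snd (F i) \<and> (\<forall>j<B. fst s' j = fst (F i) j) \<and>
     fst s' k = i \<and> (\<forall>j<k. B \<le> j \<longrightarrow> fst s' j = fst s j) \<and> i \<le> N" for i and s' :: state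
  have guard: "bval (Neg (Le (Reg B) (Reg k))) s' \<longleftrightarrow> i < N" if "I i s'" for i s'
  proof -
    have "fst s' B = N" "fst s' k = i" using that x HFor.prems(3) by (auto simp: I_def)
    then show ?thesis by auto
  qed
  have body: "runs (Seq (Assign x (Reg k)) (Seq (ccom B c (k + 1)) (Assign k (Add (Reg k) (Num 1)))))
      (1 + (tcom c N + 1)) s' (I (Suc i))" if i: "i < N" and I: "I i s'" for i s'
  proof (rule runs_Seq, rule runs_Assign, rule runs_SeqI)
    show "runs (ccom B c (k + 1)) (tcom c N) ((fst s')(x := aval (Reg k) s'), snd s')
      (\<lambda>s''. snd s'' = snd (F (Suc i)) \<and> (\<forall>j<B. fst s'' j = fst (F (Suc i)) j) \<and>
       (\<forall>j<k + 1. B \<le> j \<longrightarrow> fst s'' j = fst ((fst s')(x := aval (Reg k) s'), snd s') j))"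
      unfolding FSuc by (rule HFor.IH) (use c x I HFor.prems(3) in \<open>auto simp: I_def\<close>)
  next
    fix s'' assume a: "snd s'' = snd (F (Suc i)) \<and> (\<forall>j<B. fst s'' j = fst (F (Suc i)) j) \<and>
       (\<forall>j<k + 1. B \<le> j \<longrightarrow> fst s'' j = fst ((fst s')(x := aval (Reg k) s'), snd s') j)"
    have "fst s'' k = i" using a x I by (auto simp: I_def)
    moreover have "fst s'' j = fst s j" if "j < k" "B \<le> j" for j
      using a x I that by (auto simp: I_def)
    ultimately show "runs (Assign k (Add (Reg k) (Num 1))) 1 s'' (I (Suc i))"
      using a x i by (intro runs_Assign) (auto simp: I_def)
  qed
  have init: "I 0 ((fst s)(k := 0), snd s)"
    using x HFor.prems by (auto simp: I_def F0)
  have final: "snd (hrun N (HFor x c) z) = snd (F N)"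
    "fst (hrun N (HFor x c) z) = (fst (F N))(x := 0)"
    by (simp_all add: F_def Let_def)
  show ?case unfolding ccom.simps tcom.simps final
    apply (rule runs_Seq, rule runs_Assign)
    apply (rule runs_Seq)
    apply (rule runs_While_count[where I = I, OF body guard])
    using init apply simp_all
    subgoal for s' by (rule runs_Assign[unfolded One_nat_def]) (use x in \<open>auto simp: I_def\<close>)
    done
qed

text \<open>The input length is copied to register \<open>B\<close> before the program can overwrite
  register 0. This assignment is the extra step in \<open>1 + p\<close>.\<close>

lemma poly_time_computableI:
  assumes "cregs_below B c" "0 < B"
    and "\<And>x. x \<in> X \<Longrightarrow> fst (hrun (length (enc x)) c (init_state (enc x))) 0 = f x"
  shows "poly_time_computable X enc f"
proof -
  obtain p where p: "tcom c N = poly p N" for N using tcom_poly by blast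
  have "computes_within (Seq (Assign B (Reg 0)) (ccom B c (Suc B))) (enc x)
      (poly (1 + p) (length (enc x))) (f x)" if "x \<in> X" for x
  proof -
    let ?N = "length (enc x)"
    have "runs (Seq (Assign B (Reg 0)) (ccom B c (Suc B))) (1 + tcom c ?N) (init_state (enc x))
       (\<lambda>s. fst s 0 = f x)"
      apply (rule runs_Seq, rule runs_Assign)
      apply (rule runs_mono)
        apply (rule runs_ccom[OF assms(1), where z = "init_state (enc x)" and N = ?N])
      using assms(2) assms(3)[OF that] by (auto simp: init_state_def)
    then show ?thesis by (auto simp: computes_within_def runs_def p)
  qed
  then show ?thesis unfolding poly_time_computable_def by blast
qed

section \<open>Bipartite matching by auction\<close>

text \<open>\<open>own j\<close> is 0 for an unsold item and \<open>Suc i\<close> for owner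
  \<open>i\<close>, so cleared arrays form an initial state. The fourth conjunct is the approximate
  complementary slackness of auction algorithms: an owner pays at most one more than the price of
  any neighbour.\<close>

definition auction_inv :: "(nat \<Rightarrow> nat \<Rightarrow> bool) \<Rightarrow> nat \<Rightarrow> (nat \<Rightarrow> nat) \<Rightarrow> (nat \<Rightarrow> nat) \<Rightarrow> bool" where
  "auction_inv E K own p \<longleftrightarrow>
     (\<forall>j. own j = 0 \<longleftrightarrow> p j = 0) \<and>
     (\<forall>i j. own j = Suc i \<longrightarrow> E i j) \<and>
     (\<forall>i j j'. own j = Suc i \<longrightarrow> own j' = Suc i \<longrightarrow> j = j') \<and>
     (\<forall>i j j'. own j = Suc i \<longrightarrow> E i j' \<longrightarrow> p j \<le> Suc (p j')) \<and>
     (\<forall>j. p j \<le> K)"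

text \<open>The cap \<open>K\<close> keeps prices, and with them the number of bids, bounded. A
  bidder whose neighbours have all reached it gives up.\<close>

definition bid_allowed ::
    "(nat \<Rightarrow> nat \<Rightarrow> bool) \<Rightarrow> nat \<Rightarrow> (nat \<Rightarrow> nat) \<Rightarrow> (nat \<Rightarrow> nat) \<Rightarrow> nat \<Rightarrow> nat \<Rightarrow> bool" where
  "bid_allowed E K own p i j \<longleftrightarrow>
     E i j \<and> (\<forall>j'. own j' \<noteq> Suc i) \<and> p j < K \<and> (\<forall>j'. E i j' \<longrightarrow> p j \<le> p j')"

definition auction_stable ::
    "(nat \<Rightarrow> nat \<Rightarrow> bool) \<Rightarrow> nat \<Rightarrow> (nat \<Rightarrow> nat) \<Rightarrow> (nat \<Rightarrow> nat) \<Rightarrow> bool" where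
  "auction_stable E K own p \<longleftrightarrow> (\<forall>i j. \<not> bid_allowed E K own p i j)"

lemma auction_inv_init: "auction_inv E K (\<lambda>_. 0) (\<lambda>_. 0)"
  by (simp add: auction_inv_def)

text \<open>The item bought was a cheapest neighbour, so after the increment it costs at most one
  more than the others. For the remaining owners a raised price of \<open>j\<close> only weakens the
  slackness inequality.\<close>

lemma auction_inv_bid:
  assumes inv: "auction_inv E K own p" and bid: "bid_allowed E K own p i j"
  shows "auction_inv E K (own(j := Suc i)) (p(j := Suc (p j)))"
proof -
  from inv have 1: "own j1 = 0 \<longleftrightarrow> p j1 = 0" and 2: "own j1 = Suc i1 \<Longrightarrow> E i1 j1"
    and 3: "own j1 = Suc i1 \<Longrightarrow> own j2 = Suc i1 \<Longrightarrow> j1 = j2"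
    and 4: "own j1 = Suc i1 \<Longrightarrow> E i1 j2 \<Longrightarrow> p j1 \<le> Suc (p j2)" and 5: "p j1 \<le> K" for i1 j1 j2
    unfolding auction_inv_def by simp_all
  from bid have b: "E i j" "\<And>j1. own j1 \<noteq> Suc i" "p j < K" "\<And>j1. E i j1 \<Longrightarrow> p j \<le> p j1"
    unfolding bid_allowed_def by simp_all
  show ?thesis
    unfolding auction_inv_def
  proof (intro conjI allI impI)
    fix i1 j1 j2 assume "(own(j := Suc i)) j1 = Suc i1" "E i1 j2"
    then show "(p(j := Suc (p j))) j1 \<le> Suc ((p(j := Suc (p j))) j2)"
      using 4[of j1 i1 j2] b(4)[of j2] by (auto split: if_splits)
  next
    fix i1 j1 j2 assume "(own(j := Suc i)) j1 = Suc i1" "(own(j := Suc i)) j2 = Suc i1"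
    then show "j1 = j2" using 3[of j1 i1 j2] b(2)[of j1] b(2)[of j2] by (auto split: if_splits)
  next
    fix j1 show "(own(j := Suc i)) j1 = 0 \<longleftrightarrow> (p(j := Suc (p j))) j1 = 0" using 1[of j1] by simp
  next
    fix i1 j1 assume "(own(j := Suc i)) j1 = Suc i1"
    then show "E i1 j1" using 2[of j1 i1] b(1) by (auto split: if_splits)
  next
    fix j1 show "(p(j := Suc (p j))) j1 \<le> K" using 5[of j1] b(3) by simp
  qed
qed

locale stable_auction =
  fixes L R :: "nat set" and E :: "nat \<Rightarrow> nat \<Rightarrow> bool" and K :: nat and own p :: "nat \<Rightarrow> nat"
  assumes fin: "finite L" "finite R" and disj: "L \<inter> R = {}"
    and edges: "\<And>i j. E i j \<Longrightarrow> i \<in> L \<and> j \<in> R"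
    and K: "card R < K"
    and inv: "auction_inv E K own p" and stable: "auction_stable E K own p"
begin

definition sold :: "nat set" where "sold = {j. 0 < p j}"

lemma own_eq_0: "own j = 0 \<longleftrightarrow> p j = 0"
  and own_edge: "own j = Suc i \<Longrightarrow> E i j"
  and own_unique: "own j = Suc i \<Longrightarrow> own j' = Suc i \<Longrightarrow> j = j'"
  and own_price: "own j = Suc i \<Longrightarrow> E i j' \<Longrightarrow> p j \<le> Suc (p j')"
  using inv unfolding auction_inv_def by simp_all

lemma sold_owner: "j \<in> sold \<Longrightarrow> \<exists>i. own j = Suc i \<and> E i j"
  using own_eq_0[of j] own_edge[of j] by (cases "own j") (auto simp: sold_def)

lemma sold_subset: "sold \<subseteq> R"
  using sold_owner edges by blast

lemma finite_sold: "finite sold"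
  using sold_subset fin finite_subset by blast

text \<open>Weak duality. Sold items with their owners form a matching, and \<open>X\<close> misses
  an endpoint of each matching edge; \<open>f\<close> selects a missed endpoint
  (\<open>own j - 1\<close> decodes the owner), injectively as matching edges are disjoint.\<close>

lemma card_independent_le:
  assumes X: "X \<subseteq> L \<union> R" and indep: "\<And>i j. i \<in> X \<Longrightarrow> j \<in> X \<Longrightarrow> \<not> E i j"
  shows "card X + card sold \<le> card L + card R"
proof -
  define f where "f j = (if j \<in> X then own j - 1 else j)" for j
  have img: "f ` sold \<subseteq> (L \<union> R) - X"
  proof (rule image_subsetI)
    fix j assume j: "j \<in> sold"
    obtain i where "own j = Suc i" "E i j" using sold_owner[OF j] by blast
    then show "f j \<in> L \<union> R - X" using indep[of i j] edges[of i j] by (auto simp: f_def)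
  qed
  have "inj_on f sold"
  proof (rule inj_onI)
    fix j j' assume j: "j \<in> sold" and j': "j' \<in> sold" and eq: "f j = f j'"
    obtain i where i: "own j = Suc i" "E i j" using sold_owner[OF j] by blast
    obtain i' where i': "own j' = Suc i'" "E i' j'" using sold_owner[OF j'] by blast
    have uniq: "own j = own j' \<Longrightarrow> j = j'" using own_unique i by metis
    show "j = j'"
      using eq uniq i i' edges[of i j] edges[of i' j'] disj by (auto simp: f_def split: if_splits)
  qed
  then have "card sold \<le> card ((L \<union> R) - X)"
    using img fin card_inj_on_le by (metis finite_Diff finite_Un)
  also have "\<dots> = card (L \<union> R) - card X"
    using X fin by (meson card_Diff_subset finite_Un finite_subset)
  also have "card (L \<union> R) = card L + card R" using fin disj by (rule card_Un_disjoint)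
  finally show ?thesis
    using card_mono[OF _ X] fin \<open>card (L \<union> R) = card L + card R\<close> by auto
qed

text \<open>
  Some price level \<open>k\<close> in \<open>{1..K}\<close> is not attained. The items above level \<open>k\<close>, together with the
  bidders that see an item below level \<open>k\<close>, form a vertex cover; a price gap cannot be crossed by an
  owned item, so the cover meets every matching edge exactly once.
\<close>

lemma exists_independent:
  "\<exists>X \<subseteq> L \<union> R. (\<forall>i\<in>X. \<forall>j\<in>X. \<not> E i j) \<and> card L + card R \<le> card X + card sold"
proof -
  \<comment> \<open>Pigeonhole: there are more levels than items, by
    \<open>card R < K\<close>.\<close>
  have "\<exists>k\<in>{1..K}. \<forall>j\<in>R. p j \<noteq> k"
  proof (rule ccontr)
    assume "\<not> ?thesis"
    then have *: "\<And>k. k \<in> {1..K} \<Longrightarrow> \<exists>j\<in>R. p j = k" by blast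
    have "{1..K} \<subseteq> p ` R"
    proof
      fix k assume "k \<in> {1..K}"
      from *[OF this] show "k \<in> p ` R" by auto
    qed
    then have "card {1..K} \<le> card R" using surj_card_le fin by blast
    then show False using K by simp
  qed
  then obtain k where k: "1 \<le> k" "k \<le> K" "\<And>j. j \<in> R \<Longrightarrow> p j \<noteq> k" by auto
  define Hi where "Hi = {j \<in> R. k < p j}"
  define Lo where "Lo = {i \<in> L. \<exists>j. E i j \<and> p j < k}"
  \<comment> \<open>If \<open>i\<close> owned nothing, its cheapest neighbour would cost less than
    \<open>k \<le> K\<close> and a bid would be allowed, against stability. By slackness the owned
    item costs at most \<open>k\<close>, and the gap at \<open>k\<close> excludes equality.\<close>
  have own_Lo: "\<exists>j. own j = Suc i \<and> p j < k \<and> j \<in> sold" if i: "i \<in> Lo" for i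
  proof -
    obtain j0 where j0: "E i j0" "p j0 < k" using i by (auto simp: Lo_def)
    have "\<exists>j. own j = Suc i"
    proof (rule ccontr)
      assume n: "\<not> ?thesis"
      obtain j1 where j1: "E i j1" "\<And>j'. E i j' \<Longrightarrow> p j1 \<le> p j'"
        using ex_has_least_nat[of "E i" j0 p] j0 by blast
      then have "p j1 < K" using j0 k by (meson le_less_trans less_le_trans)
      with j1 n have "bid_allowed E K own p i j1" by (auto simp: bid_allowed_def)
      then show False using stable by (auto simp: auction_stable_def)
    qed
    then obtain j where j: "own j = Suc i" by blast
    have "p j \<le> Suc (p j0)" using own_price[OF j j0(1)] .
    moreover have "E i j" using own_edge[OF j] .
    moreover have "p j \<noteq> 0" using own_eq_0[of j] j by simp
    moreover have "p j \<noteq> k" using k(3) edges[OF \<open>E i j\<close>] by blast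
    ultimately have "p j < k" "j \<in> sold" using j0(2) by (auto simp: sold_def)
    then show ?thesis using j by blast
  qed
  \<comment> \<open>Distinct bidders own distinct items, and those chosen cost less than
    \<open>k\<close>, hence lie outside \<open>Hi\<close>. This bounds the cover
    \<open>Lo \<union> Hi\<close> by the number of sold items.\<close>
  define g where "g i = (SOME j. own j = Suc i \<and> p j < k \<and> j \<in> sold)" for i
  have g: "own (g i) = Suc i \<and> p (g i) < k \<and> g i \<in> sold" if "i \<in> Lo" for i
    unfolding g_def by (rule someI_ex[OF own_Lo[OF that]])
  have "inj_on g Lo"
  proof (rule inj_onI)
    fix i i' assume "i \<in> Lo" "i' \<in> Lo" "g i = g i'"
    then have "Suc i = Suc i'" using g[of i] g[of i'] by metis
    then show "i = i'" by simp
  qed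
  then have "card Lo = card (g ` Lo)" by (simp add: card_image)
  moreover have "g ` Lo \<subseteq> sold - Hi"
  proof (rule image_subsetI)
    fix i assume "i \<in> Lo"
    from g[OF this] show "g i \<in> sold - Hi" by (simp add: Hi_def)
  qed
  moreover have Hi: "Hi \<subseteq> sold" by (auto simp: Hi_def sold_def)
  moreover have "card (sold - Hi) = card sold - card Hi"
    using Hi finite_sold by (intro card_Diff_subset) (auto intro: finite_subset)
  ultimately have "card Lo \<le> card sold - card Hi"
    using card_mono[of "sold - Hi" "g ` Lo"] finite_sold by simp
  then have c: "card Lo + card Hi \<le> card sold" using card_mono[OF finite_sold Hi] by linarith
  \<comment> \<open>The complement of the vertex cover.\<close>
  define X where "X = (L - Lo) \<union> (R - Hi)"
  have LoL: "Lo \<subseteq> L" and HiR: "Hi \<subseteq> R" by (auto simp: Lo_def Hi_def)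
  have "card X = card (L - Lo) + card (R - Hi)"
    unfolding X_def using disj fin by (intro card_Un_disjoint) auto
  moreover have "card (L - Lo) = card L - card Lo" "card (R - Hi) = card R - card Hi"
    using LoL HiR fin by (auto intro!: card_Diff_subset intro: finite_subset)
  ultimately have "card L + card R \<le> card X + card sold" using c by linarith
  moreover have "\<not> E i j" if "i \<in> X" "j \<in> X" for i j
  proof
    assume e: "E i j"
    then have "i \<in> L" "j \<in> R" using edges by blast+
    then have "i \<notin> Lo" "j \<notin> Hi" using that disj by (auto simp: X_def)
    then have "\<not> p j < k" "\<not> k < p j" using e \<open>i \<in> L\<close> \<open>j \<in> R\<close> by (auto simp: Lo_def Hi_def)
    then show False using k(3)[OF \<open>j \<in> R\<close>] by simp
  qed
  moreover have "X \<subseteq> L \<union> R" by (auto simp: X_def)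
  ultimately show ?thesis by blast
qed

end

section \<open>The sides of a split graph\<close>

definition deg :: "nat \<Rightarrow> (nat \<Rightarrow> nat \<Rightarrow> bool) \<Rightarrow> nat \<Rightarrow> nat" where
  "deg n a v = card {u. u < n \<and> a v u}"

text \<open>Ties are broken by index to make this a strict total order.\<close>

definition precedes :: "nat \<Rightarrow> (nat \<Rightarrow> nat \<Rightarrow> bool) \<Rightarrow> nat \<Rightarrow> nat \<Rightarrow> bool" where
  "precedes n a u v \<longleftrightarrow> deg n a v < deg n a u \<or> deg n a v = deg n a u \<and> u < v"

definition core :: "nat \<Rightarrow> (nat \<Rightarrow> nat \<Rightarrow> bool) \<Rightarrow> nat \<Rightarrow> bool" where
  "core n a v \<longleftrightarrow> v < n \<and> (\<forall>u<n. precedes n a u v \<longrightarrow> a u v)"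

text \<open>One of two distinct vertices precedes the other, and the core condition of the later one
  yields the edge.\<close>

lemma core_clique:
  assumes sym: "\<And>u v. u < n \<Longrightarrow> v < n \<Longrightarrow> a u v \<Longrightarrow> a v u"
    and "core n a u" "core n a v" "u \<noteq> v"
  shows "a u v"
proof -
  have "precedes n a u v \<or> precedes n a v u" using \<open>u \<noteq> v\<close> by (auto simp: precedes_def)
  then show ?thesis using assms by (auto simp: core_def)
qed

text \<open>
  Among the clique sides of maximal size take one with minimal sum of indices. A vertex outside it
  then never precedes a vertex inside it, since otherwise the two could be exchanged.
\<close>

lemma not_core_independent:
  fixes n :: nat
  assumes sym: "\<And>u v. u < n \<Longrightarrow> v < n \<Longrightarrow> a u v \<Longrightarrow> a v u"
    and irr: "\<And>u. u < n \<Longrightarrow> \<not> a u u"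
    and split: "C0 \<subseteq> {..<n}" "\<forall>u\<in>C0. \<forall>v\<in>C0. u \<noteq> v \<longrightarrow> a u v"
      "\<forall>u\<in>{..<n} - C0. \<forall>v\<in>{..<n} - C0. \<not> a u v"
    and uv: "u < n" "v < n" "\<not> core n a u" "\<not> core n a v"
  shows "\<not> a u v"
proof -
  define P where "P C \<longleftrightarrow> C \<subseteq> {..<n} \<and> (\<forall>u\<in>C. \<forall>v\<in>C. u \<noteq> v \<longrightarrow> a u v) \<and>
     (\<forall>u\<in>{..<n} - C. \<forall>v\<in>{..<n} - C. \<not> a u v)" for C
  have "P C0" using split by (simp add: P_def)
  have bound: "card C \<le> n" if "P C" for C
    using that card_mono[of "{..<n}" C] by (auto simp: P_def)
  obtain C1 where C1: "P C1" "\<And>C. P C \<Longrightarrow> card C \<le> card C1"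
    using ex_has_greatest_nat[of P C0 card "Suc n"] \<open>P C0\<close> bound by (auto simp: less_Suc_eq_le)
  obtain C where C: "P C" "card C = card C1"
    and min: "\<And>C'. P C' \<Longrightarrow> card C' = card C1 \<Longrightarrow> \<Sum>C \<le> \<Sum>C'"
    using ex_has_least_nat[of "\<lambda>C. P C \<and> card C = card C1" C1 "\<lambda>C. \<Sum>C"] C1 by auto
  have max: "card C' \<le> card C" if "P C'" for C' using C1(2)[OF that] C(2) by simp
  have Cn: "C \<subseteq> {..<n}" and cl: "\<And>u v. u \<in> C \<Longrightarrow> v \<in> C \<Longrightarrow> u \<noteq> v \<Longrightarrow> a u v"
    and ind: "\<And>u v. u < n \<Longrightarrow> v < n \<Longrightarrow> u \<notin> C \<Longrightarrow> v \<notin> C \<Longrightarrow> \<not> a u v"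
    using C(1) by (auto simp: P_def)
  have fin: "finite C" using Cn finite_subset by blast
  \<comment> \<open>Otherwise \<open>s\<close> could be added to \<open>C\<close>, against
    maximality.\<close>
  have nonadj: "\<exists>c\<in>C. \<not> a s c" if s: "s < n" "s \<notin> C" for s
  proof (rule ccontr)
    assume "\<not> ?thesis"
    then have all: "\<And>c. c \<in> C \<Longrightarrow> a s c" by blast
    then have "\<And>c. c \<in> C \<Longrightarrow> a c s" using sym s Cn by blast
    then have "P (insert s C)" using all cl ind s Cn by (auto simp: P_def)
    from max[OF this] show False using s fin by simp
  qed
  have not_before: "\<not> precedes n a s c" if s: "s < n" "s \<notin> C" and c: "c \<in> C" for s c
  proof
    assume pre: "precedes n a s c"
    let ?N = "\<lambda>v. {u. u < n \<and> a v u}"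
    have c_n: "c < n" using c Cn by auto
    obtain d where d: "d \<in> C" "\<not> a s d" using nonadj[OF s] by blast
    \<comment> \<open>All neighbours of \<open>s\<close> lie in \<open>C\<close>, because the
      outside is independent, and \<open>d\<close> is not among them.\<close>
    have Ns: "?N s \<subseteq> C - {d}" using ind s d by auto
    have Nc: "C - {c} \<subseteq> ?N c" using cl c Cn by auto
    have finN: "finite (?N v)" for v by simp
    have "deg n a s \<le> card C - 1"
      using card_mono[OF _ Ns] fin d by (simp add: deg_def card_Diff_singleton)
    moreover have "card C - 1 \<le> deg n a c"
      using card_mono[OF finN Nc] fin c by (simp add: deg_def card_Diff_singleton)
    \<comment> \<open>Since \<open>deg n a s \<le> card C - 1 \<le> deg n a c\<close>, only the
      tie-break can put \<open>s\<close> first; hence equal degrees and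
      \<open>s < c\<close>.\<close>
    ultimately have deq: "deg n a s = card C - 1" "deg n a c = card C - 1" and sc: "s < c"
      using pre by (auto simp: precedes_def)
    have Ns': "?N s = C - {d}"
      using card_subset_eq[OF _ Ns] fin d deq by (simp add: deg_def card_Diff_singleton)
    have Nc': "?N c = C - {c}"
      using card_subset_eq[OF finN Nc] fin c deq by (simp add: deg_def card_Diff_singleton)
    have "\<not> a c s" using Nc' s by auto
    then have "\<not> a s c" using sym s c_n by blast
    then have dc: "d = c" using Ns' c c_n by blast
    have as: "a s x" "a x s" if "x \<in> C - {c}" for x
      using Ns' dc that Cn sym s by (blast, blast)
    have ac: "\<not> a c x" "\<not> a x c" if "x < n" "x \<notin> C - {c}" for x
      using Nc' that sym c_n by (blast, blast)
    \<comment> \<open>Now \<open>s\<close> and \<open>c\<close> have the same neighbours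
      \<open>C - {c}\<close>. Exchanging them keeps the size of the clique side and lowers its index
      sum, against the choice of \<open>C\<close>.\<close>
    let ?C = "insert s (C - {c})"
    have "P ?C"
      unfolding P_def
    proof (intro conjI ballI impI)
      show "?C \<subseteq> {..<n}" using Cn s by auto
    next
      fix u v assume "u \<in> ?C" "v \<in> ?C" "u \<noteq> v"
      then show "a u v" using as cl by auto
    next
      fix u v assume "u \<in> {..<n} - ?C" "v \<in> {..<n} - ?C"
      then show "\<not> a u v" using ac ind by (cases "u = c"; cases "v = c") auto
    qed
    moreover have "card ?C = card C1"
      using fin s C(2) card_Suc_Diff1[OF fin c] by (subst card_insert_disjoint) auto
    ultimately have "\<Sum>C \<le> \<Sum>?C" by (rule min)
    also have "\<Sum>?C = s + \<Sum>(C - {c})" using fin s by simp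
    also have "\<dots> < c + \<Sum>(C - {c})" using sc by simp
    also have "\<dots> = \<Sum>C" using fin c by (simp add: sum.remove)
    finally show False by simp
  qed
  \<comment> \<open>All predecessors of a vertex of \<open>C\<close> lie in \<open>C\<close> by
    \<open>not_before\<close>, so they are adjacent to it. Hence vertices outside the core are
    outside \<open>C\<close>.\<close>
  have "core n a v" if "v \<in> C" for v
    unfolding core_def using that Cn cl not_before irr by (metis (no_types, lifting) lessThan_iff less_irrefl precedes_def subsetD)
  then show ?thesis using uv ind by blast
qed

section \<open>Independent sets in the product\<close>

locale split_pair =
  fixes n m :: nat and a b :: "nat \<Rightarrow> nat \<Rightarrow> bool" and P Q :: "nat \<Rightarrow> bool"
  assumes a_sym: "\<And>u v. u < n \<Longrightarrow> v < n \<Longrightarrow> a u v \<Longrightarrow> a v u" and a_irr: "\<And>u. u < n \<Longrightarrow> \<not> a u u"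
    and b_sym: "\<And>u v. u < m \<Longrightarrow> v < m \<Longrightarrow> b u v \<Longrightarrow> b v u" and b_irr: "\<And>u. u < m \<Longrightarrow> \<not> b u u"
    and P_clique: "\<And>u v. u < n \<Longrightarrow> v < n \<Longrightarrow> P u \<Longrightarrow> P v \<Longrightarrow> u \<noteq> v \<Longrightarrow> a u v"
    and P_indep: "\<And>u v. u < n \<Longrightarrow> v < n \<Longrightarrow> \<not> P u \<Longrightarrow> \<not> P v \<Longrightarrow> \<not> a u v"
    and Q_clique: "\<And>u v. u < m \<Longrightarrow> v < m \<Longrightarrow> Q u \<Longrightarrow> Q v \<Longrightarrow> u \<noteq> v \<Longrightarrow> b u v"
    and Q_indep: "\<And>u v. u < m \<Longrightarrow> v < m \<Longrightarrow> \<not> Q u \<Longrightarrow> \<not> Q v \<Longrightarrow> \<not> b u v"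
begin

text \<open>The pair \<open>(g, h)\<close> is coded as the number \<open>g * m + h\<close>.\<close>

definition padj :: "nat \<Rightarrow> nat \<Rightarrow> bool" where
  "padj u v \<longleftrightarrow> a (u div m) (v div m) \<and> b (u mod m) (v mod m)"

definition indep :: "nat set \<Rightarrow> bool" where
  "indep I \<longleftrightarrow> I \<subseteq> {..<n * m} \<and> (\<forall>u\<in>I. \<forall>v\<in>I. \<not> padj u v)"

text \<open>
  The admissible traces of an independent set on the product of the cliques: the cell \<open>(c, d)\<close>, the
  row \<open>c\<close> (if \<open>d \<ge> m\<close>), the column \<open>d\<close> (if \<open>c \<ge> n\<close>), or nothing (if both are out of range).
\<close>

definition inX :: "nat \<Rightarrow> nat \<Rightarrow> nat \<Rightarrow> bool" where
  "inX c d k \<longleftrightarrow> k < n * m \<and> P (k div m) \<and> Q (k mod m) \<and> (c < n \<longrightarrow> k div m = c) \<and>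
     (d < m \<longrightarrow> k mod m = d) \<and> (c < n \<or> d < m)"

text \<open>The test \<open>c < n\<close> orients the bipartition. With a row or a cell,
  non-neighbours in \<open>S \<times> C'\<close> join the left side, and all of
  \<open>(C \<union> S) \<times> S'\<close> forms the right side \<open>inR\<close>. With a column
  or an empty trace the two factors swap roles.\<close>

definition inL :: "nat \<Rightarrow> nat \<Rightarrow> nat \<Rightarrow> bool" where
  "inL c d k \<longleftrightarrow> inX c d k \<or> k < n * m \<and> (P (k div m) \<longleftrightarrow> \<not> c < n) \<and> (Q (k mod m) \<longleftrightarrow> c < n) \<and>
     (\<forall>x. inX c d x \<longrightarrow> \<not> padj x k)"

definition inR :: "nat \<Rightarrow> nat \<Rightarrow> nat \<Rightarrow> bool" where
  "inR c d k \<longleftrightarrow> k < n * m \<and> (if c < n then \<not> Q (k mod m) else \<not> P (k div m))"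

lemma coords:
  assumes "k < n * m" shows "k div m < n" "k mod m < m"
  using assms by (simp add: less_mult_imp_div_less, cases "m = 0", simp_all)

lemma coords_inj: "u div m = v div m \<Longrightarrow> u mod m = v mod m \<Longrightarrow> u = v"
  by (metis div_mult_mod_eq)

lemma padj_sym: "u < n * m \<Longrightarrow> v < n * m \<Longrightarrow> padj u v \<Longrightarrow> padj v u"
  using a_sym b_sym coords by (simp add: padj_def)

lemma inX_indep: "inX c d u \<Longrightarrow> inX c d v \<Longrightarrow> \<not> padj u v"
  using a_irr[of c] b_irr[of d] by (auto simp: inX_def padj_def)

lemma inL_less: "inL c d k \<Longrightarrow> k < n * m" and inR_less: "inR c d k \<Longrightarrow> k < n * m"
  by (auto simp: inL_def inX_def inR_def)

text \<open>The trace lies in one row or column and adjacency is irreflexive; the added vertices are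
  non-neighbours of the trace and have one coordinate in an independent side.\<close>

lemma inL_indep:
  assumes "inL c d u" "inL c d v" shows "\<not> padj u v"
proof -
  have l: "u < n * m" "v < n * m" using assms inL_less by auto
  show ?thesis
  proof (cases "inX c d u \<or> inX c d v")
    case True
    then show ?thesis using assms inX_indep padj_sym[OF l] by (auto simp: inL_def)
  next
    case False
    then show ?thesis
      using assms P_indep[of "u div m" "v div m"] Q_indep[of "u mod m" "v mod m"] coords[OF l(1)] coords[OF l(2)]
      by (auto simp: inL_def padj_def)
  qed
qed

lemma inR_indep: "inR c d u \<Longrightarrow> inR c d v \<Longrightarrow> \<not> padj u v"
  using P_indep[of "u div m" "v div m"] Q_indep[of "u mod m" "v mod m"] coords[of u] coords[of v]
  by (auto simp: inR_def padj_def split: if_splits)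

lemma inL_inR_disjoint: "inL c d k \<Longrightarrow> \<not> inR c d k"
  by (auto simp: inL_def inR_def inX_def)

text \<open>Only two of the four blocks need an argument: the product of the cliques and the mixed
  block contributing to \<open>inL\<close>. The other two blocks make up \<open>inR\<close>.\<close>

lemma indep_coverI:
  assumes I: "indep I"
    and X: "\<And>k. k \<in> I \<Longrightarrow> P (k div m) \<Longrightarrow> Q (k mod m) \<Longrightarrow> inX c d k"
    and NX: "\<And>x k. k \<in> I \<Longrightarrow> (P (k div m) \<longleftrightarrow> \<not> c < n) \<Longrightarrow> (Q (k mod m) \<longleftrightarrow> c < n) \<Longrightarrow> inX c d x \<Longrightarrow> \<not> padj x k"
  shows "I \<subseteq> {k. inL c d k \<or> inR c d k}"
proof
  fix k assume k: "k \<in> I"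
  then have "k < n * m" using I by (auto simp: indep_def)
  then show "k \<in> {k. inL c d k \<or> inR c d k}"
    using X[OF k] NX[OF k] by (auto simp: inL_def inR_def)
qed

lemma indep_covered:
  assumes I: "indep I"
  shows "\<exists>c\<le>n. \<exists>d\<le>m. I \<subseteq> {k. inL c d k \<or> inR c d k}"
proof -
  have less: "k < n * m" if "k \<in> I" for k using I that by (auto simp: indep_def)
  have nadj: "\<not> padj u v" if "u \<in> I" "v \<in> I" for u v using I that by (auto simp: indep_def)
  define Y where "Y = {k \<in> I. P (k div m) \<and> Q (k mod m)}"
  \<comment> \<open>Two cells of \<open>C \<times> C'\<close> that differ in both coordinates are
    adjacent.\<close>
  have aligned: "u div m = v div m \<or> u mod m = v mod m" if "u \<in> Y" "v \<in> Y" for u v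
    using nadj[of u v] that P_clique[of "u div m" "v div m"] Q_clique[of "u mod m" "v mod m"]
      coords[OF less[of u]] coords[OF less[of v]] by (auto simp: Y_def padj_def)
  consider "Y = {}" | k where "Y = {k}" | u v where "u \<in> Y" "v \<in> Y" "u \<noteq> v" by blast
  then show ?thesis
  proof cases
    case 1
    have "I \<subseteq> {k. inL n m k \<or> inR n m k}"
      by (rule indep_coverI[OF I]) (use 1 in \<open>auto simp: Y_def inX_def\<close>)
    then show ?thesis by blast
  next
    case (2 k)
    then have k: "k \<in> I" "P (k div m)" "Q (k mod m)" by (auto simp: Y_def)
    have X: "inX (k div m) (k mod m) x \<longleftrightarrow> x = k" for x
      using k less[OF k(1)] coords[OF less[OF k(1)]] coords_inj[of x k] by (auto simp: inX_def)
    have "I \<subseteq> {x. inL (k div m) (k mod m) x \<or> inR (k div m) (k mod m) x}"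
      by (rule indep_coverI[OF I]) (use 2 X nadj k in \<open>auto simp: Y_def\<close>)
    then show ?thesis using coords[OF less[OF k(1)]] by (meson less_imp_le)
  next
    case (3 u v)
    note u = coords[OF less[of u]] and v = coords[OF less[of v]]
    have uv: "u \<in> I" "v \<in> I" "P (u div m)" "Q (u mod m)" "P (v div m)" "Q (v mod m)"
      using 3 by (auto simp: Y_def)
    show ?thesis
    proof (cases "u div m = v div m")
      case True
      then have ne: "u mod m \<noteq> v mod m" using coords_inj 3 by blast
      let ?c = "u div m"
      have c: "?c < n" using u uv by blast
      have "I \<subseteq> {x. inL ?c m x \<or> inR ?c m x}"
      proof (rule indep_coverI[OF I])
        fix k assume k: "k \<in> I" "P (k div m)" "Q (k mod m)"
        then have "k \<in> Y" by (simp add: Y_def)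
        \<comment> \<open>A cell outside the row would have to share its column with both
          \<open>u\<close> and \<open>v\<close>, whose columns differ.\<close>
        then have "k div m = ?c" using aligned[of k u] aligned[of k v] 3 True ne by auto
        then show "inX ?c m k" using k less c by (auto simp: inX_def)
      next
        fix x k assume k: "k \<in> I" and "Q (k mod m) \<longleftrightarrow> ?c < n" and x: "inX ?c m x"
        then have Qk: "Q (k mod m)" using c by simp
        have xc: "x div m = ?c" using x c by (simp add: inX_def)
        note kc = coords[OF less[OF k]]
        \<comment> \<open>Given an edge in the first factor, independence of \<open>I\<close> would
          force \<open>k\<close> into the columns of both \<open>u\<close> and
          \<open>v\<close>.\<close>
        have "\<not> a ?c (k div m)"
        proof
          assume "a ?c (k div m)"
          then have "\<not> b (u mod m) (k mod m)" "\<not> b (v mod m) (k mod m)"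
            using nadj[OF uv(1) k] nadj[OF uv(2) k] True by (simp_all add: padj_def)
          then have "u mod m = k mod m" "v mod m = k mod m"
            using Q_clique kc(2) u(2)[OF uv(1)] v(2)[OF uv(2)] uv Qk by blast+
          then show False using ne by simp
        qed
        then show "\<not> padj x k" using xc by (simp add: padj_def)
      qed
      then show ?thesis using c by (meson less_imp_le order_refl)
    next
      case False
      then have eq: "u mod m = v mod m" using aligned 3 by blast
      let ?d = "u mod m"
      have d: "?d < m" using u uv by blast
      have "I \<subseteq> {x. inL n ?d x \<or> inR n ?d x}"
      proof (rule indep_coverI[OF I])
        fix k assume k: "k \<in> I" "P (k div m)" "Q (k mod m)"
        then have "k \<in> Y" by (simp add: Y_def)
        then have "k mod m = ?d" using aligned[of k u] aligned[of k v] 3 False eq by auto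
        then show "inX n ?d k" using k less d by (auto simp: inX_def)
      next
        fix x k assume k: "k \<in> I" and "P (k div m) \<longleftrightarrow> \<not> n < n" and x: "inX n ?d x"
        then have Pk: "P (k div m)" by simp
        have xd: "x mod m = ?d" using x d by (simp add: inX_def)
        note kc = coords[OF less[OF k]]
        have "\<not> b ?d (k mod m)"
        proof
          assume "b ?d (k mod m)"
          then have "\<not> a (u div m) (k div m)" "\<not> a (v div m) (k div m)"
            using nadj[OF uv(1) k] nadj[OF uv(2) k] eq by (simp_all add: padj_def)
          then have "u div m = k div m" "v div m = k div m"
            using P_clique kc(1) u(1)[OF uv(1)] v(1)[OF uv(2)] uv Pk by blast+
          then show False using False by simp
        qed
        then show "\<not> padj x k" using xd by (simp add: padj_def)
      qed
      then show ?thesis using d by (meson less_imp_le order_refl)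
    qed
  qed
qed

end

section \<open>The program\<close>

declare heval.simps(7) [simp del]

text \<open>Separating truth from value lets conditions simplify to propositions instead of numbers
  0 and 1.\<close>

definition holds :: "nat \<Rightarrow> hexp \<Rightarrow> state \<Rightarrow> bool" where
  "holds N e s \<longleftrightarrow> heval N e s \<noteq> 0"

definition hnot :: "hexp \<Rightarrow> hexp" where "hnot e = HIf e (HNum 0) (HNum 1)"
definition hand :: "hexp \<Rightarrow> hexp \<Rightarrow> hexp" where "hand e f = HIf e f (HNum 0)"
definition hor :: "hexp \<Rightarrow> hexp \<Rightarrow> hexp" where "hor e f = HIf e (HNum 1) f"
definition himp :: "hexp \<Rightarrow> hexp \<Rightarrow> hexp" where "himp e f = HIf e f (HNum 1)"
definition heq :: "hexp \<Rightarrow> hexp \<Rightarrow> hexp" where "heq e f = hand (HLe e f) (HLe f e)"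
definition hlt :: "hexp \<Rightarrow> hexp \<Rightarrow> hexp" where "hlt e f = HLe (HAdd e (HNum 1)) f"
definition hcount :: "nat \<Rightarrow> hexp \<Rightarrow> hexp" where "hcount x e = HSum x (HIf e (HNum 1) (HNum 0))"
definition hall :: "nat \<Rightarrow> hexp \<Rightarrow> hexp" where "hall x e = hnot (hcount x (hnot e))"
text \<open>Repeated addition; the result is the product only if the first factor is at most
  \<open>N\<close> and neither factor depends on \<open>x\<close>.\<close>

definition hmul :: "nat \<Rightarrow> hexp \<Rightarrow> hexp \<Rightarrow> hexp" where
  "hmul x e f = HSum x (HIf (hlt (HReg x) e) f (HNum 0))"

lemmas macro_defs = hnot_def hand_def hor_def himp_def heq_def hlt_def hcount_def hall_def hmul_def

lemma heval_HIf [simp]: "heval N (HIf b e f) s = (if holds N b s then heval N e s else heval N f s)"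
  by (simp add: holds_def heval.simps(7))

lemma holds_simps [simp]:
  "holds N (HCell a e) s \<longleftrightarrow> snd s a (heval N e s) \<noteq> 0"
  "holds N (HLe e f) s \<longleftrightarrow> heval N e s \<le> heval N f s"
  "holds N (hnot e) s \<longleftrightarrow> \<not> holds N e s"
  "holds N (hand e f) s \<longleftrightarrow> holds N e s \<and> holds N f s"
  "holds N (hor e f) s \<longleftrightarrow> holds N e s \<or> holds N f s"
  "holds N (himp e f) s \<longleftrightarrow> (holds N e s \<longrightarrow> holds N f s)"
  "holds N (hlt e f) s \<longleftrightarrow> heval N e s < heval N f s"
  "holds N (heq e f) s \<longleftrightarrow> heval N e s = heval N f s"
  by (auto simp: holds_def macro_defs)

lemma heval_hcount [simp]:
  "heval N (hcount x e) s = card {i. i < N \<and> holds N e ((fst s)(x := i), snd s)}"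
proof -
  have "heval N (hcount x e) s = (\<Sum>i<N. if holds N e ((fst s)(x := i), snd s) then 1 else 0)"
    by (simp add: hcount_def cong: if_cong)
  also have "\<dots> = card {i \<in> {..<N}. holds N e ((fst s)(x := i), snd s)}"
    by (simp add: sum.If_cases Int_def)
  finally show ?thesis by (simp add: conj_commute lessThan_def)
qed

lemma holds_hall [simp]:
  "holds N (hall x e) s \<longleftrightarrow> (\<forall>i<N. holds N e ((fst s)(x := i), snd s))"
  by (auto simp: hall_def holds_def[of N "hcount _ _"])

lemma heval_hmul:
  assumes "\<And>i. heval N e ((fst s)(x := i), snd s) = k" "\<And>i. heval N f ((fst s)(x := i), snd s) = l"
    "k \<le> N"
  shows "heval N (hmul x e f) s = k * l"
proof -
  have "heval N (hmul x e f) s = (\<Sum>i<N. if i < k then l else 0)"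
    by (simp add: hmul_def assms(1,2) cong: if_cong)
  also have "\<dots> = (\<Sum>i\<in>{..<N} \<inter> {i. i < k}. l)"
    by (simp add: sum.If_cases)
  also have "{..<N} \<inter> {i. i < k} = {..<k}" using assms(3) by auto
  finally show ?thesis by simp
qed

definition htable :: "nat \<Rightarrow> nat \<Rightarrow> hexp \<Rightarrow> hcom" where
  "htable a x e = HFor x (HStore a (HReg x) e)"

text \<open>As \<open>e\<close> does not read the array being filled, each entry can be computed
  from the store at the start of the loop.\<close>

lemma hrun_htable:
  assumes "a \<notin> arrays e"
  shows "hrun N (htable a x e) (r, m) =
    (r(x := 0), m(a := (\<lambda>v. if v < N then heval N e (r(x := v), m) else m a v)))"
proof -
  define g where "g i s = hrun N (HStore a (HReg x) e) ((fst s)(x := i), snd s)" for i s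
  define V where "V k = (\<lambda>v. if v < k then heval N e (r(x := v), m) else m a v)" for k
  have g: "g i (r', m(a := V k)) =
      (r'(x := i), m(a := (V k)(i := heval N e (r'(x := i), m))))" for i k r'
    by (simp add: g_def heval_upd_array[OF assms])
  have V: "(V k)(k := heval N e (r(x := k), m)) = V (Suc k)" for k
    by (auto simp: V_def fun_eq_iff less_Suc_eq)
  have V0: "m(a := V 0) = m" by (simp add: V_def)
  \<comment> \<open>Before the first pass \<open>x\<close> has its old value; after
    \<open>k > 0\<close> passes it holds the last index \<open>k - 1\<close>.\<close>
  have "fold g [0..<k] (r, m) = (if k = 0 then r else r(x := k - 1), m(a := V k))" for k
  proof (induction k)
    case (Suc k)
    have "fold g [0..<Suc k] (r, m) = g k (fold g [0..<k] (r, m))" by simp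
    also have "\<dots> = g k (if k = 0 then r else r(x := k - 1), m(a := V k))"
      by (simp only: Suc.IH)
    also have "\<dots> = (r(x := k), m(a := V (Suc k)))" by (cases "k = 0") (simp_all only: g, simp_all add: V)
    finally show ?case by (simp only: nat.distinct if_False diff_Suc_1)
  qed (simp add: V0)
  moreover have "hrun N (htable a x e) (r, m) =
      ((fst (fold g [0..<N] (r, m)))(x := 0), snd (fold g [0..<N] (r, m)))"
    by (simp only: htable_def hrun.simps(5) g_def[abs_def] Let_def)
  ultimately show ?thesis by (simp add: V_def)
qed

lemma hrun_ForI:
  assumes "I 0 s" and "\<And>i s. i < N \<Longrightarrow> I i s \<Longrightarrow> I (Suc i) (hrun N c ((fst s)(x := i), snd s))"
    and "\<And>s. I N s \<Longrightarrow> Q ((fst s)(x := 0), snd s)"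
  shows "Q (hrun N (HFor x c) s)"
proof -
  have "k \<le> N \<Longrightarrow> I k (fold (\<lambda>i s. hrun N c ((fst s)(x := i), snd s)) [0..<k] s)" for k
    by (induction k) (use assms(1,2) in auto)
  from assms(3)[OF this[of N]] show ?thesis by (simp add: Let_def)
qed

section \<open>Reading the graphs and their clique sides\<close>

definition run_length :: "hexp \<Rightarrow> hexp" where
  "run_length off = hcount 12 (hall 13 (himp (HLe (HReg 13) (HReg 12)) (HCell 0 (HAdd off (HReg 13)))))"

text \<open>With the row offsets tabulated, an adjacency test needs only an addition.\<close>

definition row_table :: "nat \<Rightarrow> nat \<Rightarrow> hexp \<Rightarrow> hcom" where
  "row_table row n off = htable row 11 (HAdd off (hmul 12 (HReg 11) (HReg n)))"

definition deg_table :: "nat \<Rightarrow> nat \<Rightarrow> nat \<Rightarrow> hcom" where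
  "deg_table dg row n = htable dg 11
     (hcount 12 (hand (hlt (HReg 12) (HReg n)) (HCell 0 (HAdd (HCell row (HReg 11)) (HReg 12)))))"

definition core_table :: "nat \<Rightarrow> nat \<Rightarrow> nat \<Rightarrow> nat \<Rightarrow> hcom" where
  "core_table co dg row n = htable co 11
     (hand (hlt (HReg 11) (HReg n)) (hall 12 (himp
       (hand (hlt (HReg 12) (HReg n)) (hor (hlt (HCell dg (HReg 11)) (HCell dg (HReg 12)))
         (hand (heq (HCell dg (HReg 11)) (HCell dg (HReg 12))) (hlt (HReg 12) (HReg 11)))))
       (HCell 0 (HAdd (HCell row (HReg 12)) (HReg 11))))))"

text \<open>
  Registers: 1, 2 the orders \<open>n\<close>, \<open>m\<close> of the two graphs, 3 the offset of the second code, 4 the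
  order \<open>n * m\<close> of the product. Arrays: 1, 2 offsets of the adjacency rows, 3, 4 degrees,
  5, 6 the clique sides, 7, 8 the coordinates \<open>k div m\<close> and \<open>k mod m\<close> of the product vertex \<open>k\<close>.
\<close>

definition prep_prog :: hcom where
  "prep_prog =
     HSeq (HAssign 1 (run_length (HNum 0)))
    (HSeq (HAssign 3 (HAdd (HAdd (HNum 1) (HReg 1)) (hmul 12 (HReg 1) (HReg 1))))
    (HSeq (HAssign 2 (run_length (HReg 3)))
    (HSeq (HAssign 4 (hmul 12 (HReg 1) (HReg 2)))
    (HSeq (row_table 1 1 (HAdd (HNum 1) (HReg 1)))
    (HSeq (row_table 2 2 (HAdd (HReg 3) (HAdd (HNum 1) (HReg 2))))
    (HSeq (deg_table 3 1 1)
    (HSeq (deg_table 4 2 2)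
    (HSeq (core_table 5 3 1 1)
    (HSeq (core_table 6 4 2 2)
    (HSeq (htable 7 11 (hcount 12 (HLe (HAdd (hmul 13 (HReg 12) (HReg 2)) (HReg 2)) (HReg 11))))
          (htable 8 11 (HSub (HReg 11) (hmul 12 (HCell 7 (HReg 11)) (HReg 2))))))))))))))"

lemma hrun_row_table:
  assumes "r n = k" "\<And>v. heval N off (r(11 := v), m) = off'"
    "row \<notin> arrays off" "n < 11"
  shows "\<exists>T. hrun N (row_table row n off) (r, m) = (r(11 := 0), m(row := T)) \<and>
     (\<forall>v<N. T v = off' + v * k)"
proof -
  have ar: "row \<notin> arrays (HAdd off (hmul 12 (HReg 11) (HReg n)))"
    using assms(3) by (simp add: macro_defs)
  have "heval N (HAdd off (hmul 12 (HReg 11) (HReg n))) (r(11 := v), m) = off' + v * k" if "v < N" for v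
    using that assms heval_hmul[of N "HReg 11" "(r(11 := v), m)" 12 v "HReg n" k] by simp
  then show ?thesis unfolding row_table_def hrun_htable[OF ar] by auto
qed

lemma hrun_deg_table:
  assumes "r n = k" "n < 11" "dg \<noteq> row" "dg \<noteq> 0" "k < N"
    and adj: "\<And>u v. u < k \<Longrightarrow> v < k \<Longrightarrow> m 0 (m row u + v) \<noteq> 0 \<longleftrightarrow> a u v"
  shows "\<exists>T. hrun N (deg_table dg row n) (r, m) = (r(11 := 0), m(dg := T)) \<and>
     (\<forall>v<k. T v = deg k a v)"
proof -
  let ?e = "hcount 12 (hand (hlt (HReg 12) (HReg n)) (HCell 0 (HAdd (HCell row (HReg 11)) (HReg 12))))"
  have ar: "dg \<notin> arrays ?e" using assms(3,4) by (simp add: macro_defs)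
  have "heval N ?e (r(11 := v), m) = deg k a v" if v: "v < k" for v
  proof -
    have "{i. i < N \<and> i < k \<and> m 0 (m row v + i) \<noteq> 0} = {i. i < k \<and> a v i}"
      using adj v \<open>k < N\<close> by auto
    then show ?thesis using assms(1,2) by (simp add: deg_def)
  qed
  then show ?thesis unfolding deg_table_def hrun_htable[OF ar] using \<open>k < N\<close> by auto
qed

lemma hrun_core_table:
  assumes "r n = k" "n < 11" "co \<noteq> dg" "co \<noteq> row" "co \<noteq> 0" "k < N"
    and adj: "\<And>u v. u < k \<Longrightarrow> v < k \<Longrightarrow> m 0 (m row u + v) \<noteq> 0 \<longleftrightarrow> a u v"
    and dg: "\<And>v. v < k \<Longrightarrow> m dg v = deg k a v"
  shows "\<exists>T. hrun N (core_table co dg row n) (r, m) = (r(11 := 0), m(co := T)) \<and>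
     (\<forall>v<k. T v \<noteq> 0 \<longleftrightarrow> core k a v)"
proof -
  let ?e = "(hand (hlt (HReg 11) (HReg n)) (hall 12 (himp
       (hand (hlt (HReg 12) (HReg n)) (hor (hlt (HCell dg (HReg 11)) (HCell dg (HReg 12)))
         (hand (heq (HCell dg (HReg 11)) (HCell dg (HReg 12))) (hlt (HReg 12) (HReg 11)))))
       (HCell 0 (HAdd (HCell row (HReg 12)) (HReg 11))))))"
  have ar: "co \<notin> arrays ?e" using assms(3-5) by (simp add: macro_defs)
  have "holds N ?e (r(11 := v), m) \<longleftrightarrow> core k a v" if v: "v < k" for v
  proof -
    have "holds N ?e (r(11 := v), m) \<longleftrightarrow>
      (\<forall>u<N. u < k \<and> (m dg v < m dg u \<or> m dg v = m dg u \<and> u < v) \<longrightarrow> m 0 (m row u + v) \<noteq> 0)"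
      using assms(1,2) v by simp
    also have "\<dots> \<longleftrightarrow>
      (\<forall>u<k. (m dg v < m dg u \<or> m dg v = m dg u \<and> u < v) \<longrightarrow> m 0 (m row u + v) \<noteq> 0)"
      using \<open>k < N\<close> by (meson less_trans)
    also have "\<dots> \<longleftrightarrow> (\<forall>u<k. precedes k a u v \<longrightarrow> a u v)"
      by (simp only: adj[OF _ v] dg dg[OF v] precedes_def cong: imp_cong)
    finally show ?thesis using v by (simp add: core_def)
  qed
  then show ?thesis unfolding core_table_def hrun_htable[OF ar] using \<open>k < N\<close> by (auto simp: holds_def)
qed

text \<open>A run of ones is measured by counting the positions up to which all bits are set. The
  terminating zero is visible to the bounded quantifier because \<open>k < N\<close>.\<close>

lemma heval_run_length:
  assumes "\<And>x y. heval N off (r(12 := x, 13 := y), m) = d"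
    "\<And>y. y < k \<Longrightarrow> m 0 (d + y) \<noteq> 0" "m 0 (d + k) = 0" "k < N"
  shows "heval N (run_length off) (r, m) = k"
proof -
  have "heval N (run_length off) (r, m) = card {x. x < N \<and> (\<forall>y<N. y \<le> x \<longrightarrow> m 0 (d + y) \<noteq> 0)}"
    by (simp add: run_length_def assms(1))
  also have "{x. x < N \<and> (\<forall>y<N. y \<le> x \<longrightarrow> m 0 (d + y) \<noteq> 0)} = {..<k}"
  proof (intro equalityI subsetI)
    fix x assume "x \<in> {x. x < N \<and> (\<forall>y<N. y \<le> x \<longrightarrow> m 0 (d + y) \<noteq> 0)}"
    then have "k \<le> x \<longrightarrow> m 0 (d + k) \<noteq> 0" using assms(4) by blast
    then show "x \<in> {..<k}" using assms(3) by (cases "k \<le> x") auto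
  next
    fix x assume "x \<in> {..<k}"
    then have "x < k" by simp
    then have "m 0 (d + y) \<noteq> 0" if "y \<le> x" for y using assms(2)[of y] that by simp
    moreover have "x < N" using \<open>x < k\<close> assms(4) by simp
    ultimately show "x \<in> {x. x < N \<and> (\<forall>y<N. y \<le> x \<longrightarrow> m 0 (d + y) \<noteq> 0)}" by blast
  qed
  finally show ?thesis by simp
qed

text \<open>Replaces division, which the machine does not have, by counting.\<close>

lemma card_multiples:
  fixes k m :: nat
  assumes "0 < m" "k < N"
  shows "card {x. x < N \<and> x * m + m \<le> k} = k div m"
proof -
  have *: "x * m + m \<le> k \<longleftrightarrow> x < k div m" for x
    using less_eq_div_iff_mult_less_eq[OF assms(1), of "Suc x" k] by (simp add: Suc_le_eq add.commute)
  have "k div m < N" using assms(2) by (meson div_le_dividend le_less_trans)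
  then have "{x. x < N \<and> x < k div m} = {..<k div m}" by auto
  then show ?thesis by (simp add: *)
qed

text \<open>\<open>f\<close> is the content of the input array and \<open>N\<close> the input
  length. Since \<open>N\<close> exceeds \<open>n\<close>, \<open>m\<close> and
  \<open>n * m\<close>, loops up to \<open>N\<close> reach all vertices of both graphs and of the
  product.\<close>

locale encoded_pair = split_pair n m a b "core n a" "core m b"
  for n m :: nat and a b :: "nat \<Rightarrow> nat \<Rightarrow> bool" +
  fixes f :: "nat \<Rightarrow> nat" and N :: nat
  assumes N: "n < N" "m < N" "n * m < N"
    and f1: "\<And>y. y < n \<Longrightarrow> f y \<noteq> 0" "f n = 0"
    and fa: "\<And>i j. i < n \<Longrightarrow> j < n \<Longrightarrow> f (1 + n + i * n + j) \<noteq> 0 \<longleftrightarrow> a i j"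
    and f2: "\<And>y. y < m \<Longrightarrow> f (1 + n + n * n + y) \<noteq> 0" "f (1 + n + n * n + m) = 0"
    and fb: "\<And>i j. i < m \<Longrightarrow> j < m \<Longrightarrow> f (1 + n + n * n + (1 + m) + i * m + j) \<noteq> 0 \<longleftrightarrow> b i j"
begin

definition prepared :: "state \<Rightarrow> bool" where
  "prepared s \<longleftrightarrow> fst s 1 = n \<and> fst s 2 = m \<and> fst s 4 = n * m \<and>
     (\<forall>i<n. \<forall>j<n. snd s 0 (snd s 1 i + j) \<noteq> 0 \<longleftrightarrow> a i j) \<and>
     (\<forall>i<m. \<forall>j<m. snd s 0 (snd s 2 i + j) \<noteq> 0 \<longleftrightarrow> b i j) \<and>
     (\<forall>v<n. snd s 5 v \<noteq> 0 \<longleftrightarrow> core n a v) \<and> (\<forall>v<m. snd s 6 v \<noteq> 0 \<longleftrightarrow> core m b v) \<and>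
     (\<forall>k<n * m. snd s 7 k = k div m \<and> snd s 8 k = k mod m)"

text \<open>Arrays from 9 on are left alone because the owner and price arrays have to be still zero
  when the main loop starts.\<close>

lemma prep_prog_correct:
  assumes f: "M 0 = f"
  shows "\<exists>r' M'. hrun N prep_prog (r, M) = (r', M') \<and> prepared (r', M') \<and> (\<forall>t\<ge>9. M' t = M t)"
proof -
  let ?d = "1 + n + n * n"
  define r1 where "r1 = r(1 := n, 3 := ?d, 2 := m, 4 := n * m)"
  have e1: "heval N (run_length (HNum 0)) (r, M) = n"
    by (rule heval_run_length[where d = 0]) (use f f1 N in auto)
  have e3: "heval N (HAdd (HAdd (HNum 1) (HReg 1)) (hmul 12 (HReg 1) (HReg 1))) (r(1 := n), M) = ?d"
    using heval_hmul[of N "HReg 1" "(r(1 := n), M)" 12 n "HReg 1" n] N by simp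
  have e2: "heval N (run_length (HReg 3)) (r(1 := n, 3 := ?d), M) = m"
    by (rule heval_run_length[where d = ?d]) (use f f2 N in auto)
  have e4: "heval N (hmul 12 (HReg 1) (HReg 2)) (r(1 := n, 3 := ?d, 2 := m), M) = n * m"
    by (rule heval_hmul) (use N in auto)
  define r2 where "r2 = r1(11 := 0)"
  have r1: "r1 1 = n" "r1 2 = m" "r1 3 = ?d" "r1 4 = n * m"
    and r2: "r2 1 = n" "r2 2 = m" "r2 3 = ?d" "r2 4 = n * m" "r2(11 := 0) = r2"
    by (simp_all add: r1_def r2_def)
  obtain T1 where T1: "hrun N (row_table 1 1 (HAdd (HNum 1) (HReg 1))) (r1, M) = (r2, M(1 := T1))"
    "\<And>v. v < N \<Longrightarrow> T1 v = 1 + n + v * n"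
    using hrun_row_table[of r1 1 n N "HAdd (HNum 1) (HReg 1)" M "1 + n" 1] r1 by (auto simp: r2_def)
  define M1 where "M1 = M(1 := T1)"
  obtain T2 where T2: "hrun N (row_table 2 2 (HAdd (HReg 3) (HAdd (HNum 1) (HReg 2)))) (r2, M1) = (r2, M1(2 := T2))"
    "\<And>v. v < N \<Longrightarrow> T2 v = ?d + (1 + m) + v * m"
    using hrun_row_table[of r2 2 m N "HAdd (HReg 3) (HAdd (HNum 1) (HReg 2))" M1 "?d + (1 + m)" 2] r2 by auto
  define M2 where "M2 = M1(2 := T2)"
  have adja: "M2 0 (M2 1 i + j) \<noteq> 0 \<longleftrightarrow> a i j" if "i < n" "j < n" for i j
    using fa[OF that] T1(2)[of i] that N f by (simp add: M2_def M1_def)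
  have adjb: "M2 0 (M2 2 i + j) \<noteq> 0 \<longleftrightarrow> b i j" if "i < m" "j < m" for i j
    using fb[OF that] T2(2)[of i] that N f by (simp add: M2_def M1_def add.assoc)
  obtain T3 where T3: "hrun N (deg_table 3 1 1) (r2, M2) = (r2, M2(3 := T3))"
    "\<And>v. v < n \<Longrightarrow> T3 v = deg n a v"
    using hrun_deg_table[of r2 1 n 3 1 N M2 a] r2 N adja by auto
  define M3 where "M3 = M2(3 := T3)"
  obtain T4 where T4: "hrun N (deg_table 4 2 2) (r2, M3) = (r2, M3(4 := T4))"
    "\<And>v. v < m \<Longrightarrow> T4 v = deg m b v"
    using hrun_deg_table[of r2 2 m 4 2 N M3 b] r2 N adjb by (auto simp: M3_def)
  define M4 where "M4 = M3(4 := T4)"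
  obtain T5 where T5: "hrun N (core_table 5 3 1 1) (r2, M4) = (r2, M4(5 := T5))"
    "\<And>v. v < n \<Longrightarrow> T5 v \<noteq> 0 \<longleftrightarrow> core n a v"
    using hrun_core_table[of r2 1 n 5 3 1 N M4 a] r2 N adja T3(2) by (auto simp: M4_def M3_def)
  define M5 where "M5 = M4(5 := T5)"
  obtain T6 where T6: "hrun N (core_table 6 4 2 2) (r2, M5) = (r2, M5(6 := T6))"
    "\<And>v. v < m \<Longrightarrow> T6 v \<noteq> 0 \<longleftrightarrow> core m b v"
    using hrun_core_table[of r2 2 m 6 4 2 N M5 b] r2 N adjb T4(2) by (auto simp: M5_def M4_def M3_def)
  define M6 where "M6 = M5(6 := T6)"
  let ?e7 = "hcount 12 (HLe (HAdd (hmul 13 (HReg 12) (HReg 2)) (HReg 2)) (HReg 11))"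
  define T7 where "T7 v = (if v < N then heval N ?e7 (r2(11 := v), M6) else M6 7 v)" for v
  have run7: "hrun N (htable 7 11 ?e7) (r2, M6) = (r2, M6(7 := T7))"
    by (subst hrun_htable) (simp_all add: macro_defs T7_def[abs_def] r2 del: heval.simps holds_simps heval_hcount)
  have T7: "T7 k = k div m" if k: "k < n * m" for k
  proof -
    have "0 < m" using k by (cases m) auto
    have mul: "heval N (hmul 13 (HReg 12) (HReg 2)) (r2(11 := k, 12 := x), M6) = x * m" if "x < N" for x
      by (rule heval_hmul) (use that r2 in auto)
    have "heval N ?e7 (r2(11 := k), M6) = card {x. x < N \<and> x * m + m \<le> k}"
      using r2 mul by (auto intro!: arg_cong[where f = card])
    then show ?thesis using card_multiples[of m k N] \<open>0 < m\<close> k N by (simp add: T7_def del: heval_hcount)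
  qed
  define M7 where "M7 = M6(7 := T7)"
  let ?e8 = "HSub (HReg 11) (hmul 12 (HCell 7 (HReg 11)) (HReg 2))"
  define T8 where "T8 v = (if v < N then heval N ?e8 (r2(11 := v), M7) else M7 8 v)" for v
  have run8: "hrun N (htable 8 11 ?e8) (r2, M7) = (r2, M7(8 := T8))"
    by (subst hrun_htable) (simp_all add: macro_defs T8_def[abs_def] r2 del: heval.simps holds_simps heval_hcount)
  have T8: "T8 k = k mod m" if k: "k < n * m" for k
  proof -
    have "heval N (hmul 12 (HCell 7 (HReg 11)) (HReg 2)) (r2(11 := k), M7) = k div m * m"
      by (rule heval_hmul) (use k T7[OF k] r2 N coords(1)[OF k] in \<open>auto simp: M7_def\<close>)
    then show ?thesis using k N by (simp add: T8_def minus_div_mult_eq_mod)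
  qed
  define M8 where "M8 = M7(8 := T8)"
  have run: "hrun N prep_prog (r, M) = (r2, M8)"
    unfolding prep_prog_def hrun.simps(1,3) fst_conv snd_conv e1 e3 e2 e4 r1_def[symmetric]
      T1 M1_def[symmetric] T2 M2_def[symmetric] T3 M3_def[symmetric] T4 M4_def[symmetric]
      T5 M5_def[symmetric] T6 M6_def[symmetric] run7 M7_def[symmetric] run8 M8_def[symmetric] ..
  have M8: "M8 0 = f" "M8 1 = T1" "M8 2 = T2" "M8 5 = T5" "M8 6 = T6" "M8 7 = T7" "M8 8 = T8"
    "\<And>t. 9 \<le> t \<Longrightarrow> M8 t = M t"
    using f by (simp_all add: M8_def M7_def M6_def M5_def M4_def M3_def M2_def M1_def)
  have M2: "M2 0 = f" "M2 1 = T1" "M2 2 = T2" using f by (simp_all add: M2_def M1_def)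
  have "prepared (r2, M8)"
    unfolding prepared_def fst_conv snd_conv M8 using r2 T5(2) T6(2) T7 T8 adja adjb
    unfolding M2 by simp
  then show ?thesis using run M8 by blast
qed

end

section \<open>Programs for the bipartite graphs and the auction\<close>

definition hiff :: "hexp \<Rightarrow> hexp \<Rightarrow> hexp" where "hiff e f = HIf e f (hnot f)"

lemma holds_HIf [simp]:
  "holds N (HIf b e f) s \<longleftrightarrow> (if holds N b s then holds N e s else holds N f s)"
  by (simp add: holds_def)

lemma holds_hiff [simp]: "holds N (hiff e f) s \<longleftrightarrow> (holds N e s \<longleftrightarrow> holds N f s)"
  by (simp add: hiff_def)

definition padj_exp :: "nat \<Rightarrow> nat \<Rightarrow> hexp" where
  "padj_exp x y =
     hand (HCell 0 (HAdd (HCell 1 (HCell 7 (HReg x))) (HCell 7 (HReg y))))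
          (HCell 0 (HAdd (HCell 2 (HCell 8 (HReg x))) (HCell 8 (HReg y))))"

definition X_exp :: hexp where
  "X_exp = hand (hlt (HReg 11) (HReg 4)) (hand (HCell 5 (HCell 7 (HReg 11)))
     (hand (HCell 6 (HCell 8 (HReg 11)))
     (hand (himp (hlt (HReg 5) (HReg 1)) (heq (HCell 7 (HReg 11)) (HReg 5)))
     (hand (himp (hlt (HReg 6) (HReg 2)) (heq (HCell 8 (HReg 11)) (HReg 6)))
           (hor (hlt (HReg 5) (HReg 1)) (hlt (HReg 6) (HReg 2)))))))"

definition L_exp :: hexp where
  "L_exp = hor (HCell 9 (HReg 11)) (hand (hlt (HReg 11) (HReg 4))
     (hand (hiff (HCell 5 (HCell 7 (HReg 11))) (hnot (hlt (HReg 5) (HReg 1))))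
     (hand (hiff (HCell 6 (HCell 8 (HReg 11))) (hlt (HReg 5) (HReg 1)))
           (hall 12 (himp (HCell 9 (HReg 12)) (hnot (padj_exp 12 11)))))))"

definition R_exp :: hexp where
  "R_exp = hand (hlt (HReg 11) (HReg 4))
     (HIf (hlt (HReg 5) (HReg 1)) (hnot (HCell 6 (HCell 8 (HReg 11)))) (hnot (HCell 5 (HCell 7 (HReg 11)))))"

text \<open>
  Registers 5 and 6 hold the parameters \<open>c\<close> and \<open>d\<close>; arrays 9, 10, 11 describe \<open>inX\<close>, \<open>inL\<close>, \<open>inR\<close>,
  array 12 the owners (0 for unowned, \<open>Suc i\<close> for the bidder \<open>i\<close>) and array 13 the prices.
\<close>

definition tables_prog :: hcom where
  "tables_prog = HSeq (htable 9 11 X_exp) (HSeq (htable 10 11 L_exp) (HSeq (htable 11 11 R_exp)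
     (HSeq (htable 12 11 (HNum 0)) (htable 13 11 (HNum 0)))))"

definition edge_exp :: "nat \<Rightarrow> nat \<Rightarrow> hexp" where
  "edge_exp x y = hand (HCell 10 (HReg x)) (hand (HCell 11 (HReg y)) (padj_exp x y))"

text \<open>\<open>HSum 12 (HNum 1)\<close> evaluates to \<open>N\<close>, which serves as the price
  cap \<open>K\<close>.\<close>

definition bid_exp :: hexp where
  "bid_exp = hand (edge_exp 7 8)
     (hand (hall 12 (hnot (heq (HCell 12 (HReg 12)) (HAdd (HReg 7) (HNum 1)))))
     (hand (hlt (HCell 13 (HReg 8)) (HSum 12 (HNum 1)))
           (hall 12 (himp (edge_exp 7 12) (HLe (HCell 13 (HReg 8)) (HCell 13 (HReg 12)))))))"

definition bid_prog :: hcom where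
  "bid_prog = HWhen bid_exp (HSeq (HStore 12 (HReg 8) (HAdd (HReg 7) (HNum 1)))
     (HStore 13 (HReg 8) (HAdd (HCell 13 (HReg 8)) (HNum 1))))"

definition pass_prog :: hcom where
  "pass_prog = HFor 7 (HFor 8 bid_prog)"

text \<open>The two loops merely count \<open>N * N\<close> passes. They suffice because a pass over
  an unstable state raises the sum of the prices, which stays below \<open>N * N\<close>.\<close>

definition auction_prog :: hcom where
  "auction_prog = HFor 9 (HFor 10 pass_prog)"

text \<open>By Koenig's theorem the independence number of a bipartite graph is its order minus the
  matching number; the matching edges are counted by the items with positive price.\<close>

definition value_exp :: hexp where
  "value_exp = HSub (HAdd (hcount 11 (HCell 10 (HReg 11))) (hcount 11 (HCell 11 (HReg 11))))
     (hcount 11 (HCell 13 (HReg 11)))"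

definition round_prog :: hcom where
  "round_prog = HSeq tables_prog (HSeq auction_prog
     (HAssign 0 (HIf (HLe (HReg 0) value_exp) value_exp (HReg 0))))"

text \<open>Register 0 initially contains the input length and is cleared to hold the running
  maximum. The loops include \<open>c = n\<close> and \<open>d = m\<close>, the codes for a missing
  row or column.\<close>

definition main_prog :: hcom where
  "main_prog = HSeq prep_prog (HSeq (HAssign 0 (HNum 0)) (HFor 5 (HFor 6 round_prog)))"

section \<open>The bipartite graph belonging to a trace\<close>

context split_pair
begin

definition edge :: "nat \<Rightarrow> nat \<Rightarrow> nat \<Rightarrow> nat \<Rightarrow> bool" where
  "edge c d i j \<longleftrightarrow> inL c d i \<and> inR c d j \<and> padj i j"

lemma edge_less: "edge c d i j \<Longrightarrow> i < n * m \<and> j < n * m"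
  by (auto simp: edge_def inL_less inR_less)

text \<open>Both sides are independent, so adjacency only occurs across, and by symmetry it can be
  oriented from left to right.\<close>

lemma indep_iff_edge:
  assumes "I \<subseteq> {k. inL c d k} \<union> {k. inR c d k}"
  shows "indep I \<longleftrightarrow> (\<forall>i\<in>I. \<forall>j\<in>I. \<not> edge c d i j)"
proof
  assume "indep I"
  then show "\<forall>i\<in>I. \<forall>j\<in>I. \<not> edge c d i j" by (auto simp: indep_def edge_def)
next
  assume e: "\<forall>i\<in>I. \<forall>j\<in>I. \<not> edge c d i j"
  have less: "k < n * m" if "k \<in> I" for k using assms that inL_less inR_less by blast
  have "\<not> padj u v" if u: "u \<in> I" and v: "v \<in> I" for u v
  proof
    assume p: "padj u v"
    then have p': "padj v u" using padj_sym less u v by blast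
    have "inL c d u \<or> inR c d u" "inL c d v \<or> inR c d v" using assms u v by auto
    then show False
      using p p' e u v inL_indep[of c d u v] inR_indep[of c d u v] unfolding edge_def by blast
  qed
  then show "indep I" using less by (auto simp: indep_def)
qed

text \<open>The first part keeps the running maximum from exceeding the independence number; the
  second takes care of the independent sets covered by \<open>c\<close> and
  \<open>d\<close>.\<close>

lemma stable_value:
  assumes K: "n * m < K" and inv: "auction_inv (edge c d) K own p"
    and st: "auction_stable (edge c d) K own p"
  defines "y \<equiv> card {k. inL c d k} + card {k. inR c d k} - card {j. 0 < p j}"
  shows "\<exists>I. indep I \<and> y \<le> card I"
    and "\<And>I. indep I \<Longrightarrow> I \<subseteq> {k. inL c d k} \<union> {k. inR c d k} \<Longrightarrow> card I \<le> y"
proof -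
  have sub: "{k. inL c d k} \<subseteq> {..<n * m}" "{k. inR c d k} \<subseteq> {..<n * m}"
    using inL_less inR_less by auto
  interpret stable_auction "{k. inL c d k}" "{k. inR c d k}" "edge c d" K own p
  proof
    show "finite {k. inL c d k}" "finite {k. inR c d k}" using sub finite_subset by blast+
    show "card {k. inR c d k} < K" using card_mono[OF _ sub(2)] K by simp
    show "{k. inL c d k} \<inter> {k. inR c d k} = {}" using inL_inR_disjoint by auto
  qed (use inv st in \<open>auto simp: edge_def\<close>)
  obtain I where I: "I \<subseteq> {k. inL c d k} \<union> {k. inR c d k}" "\<forall>i\<in>I. \<forall>j\<in>I. \<not> edge c d i j"
    "card {k. inL c d k} + card {k. inR c d k} \<le> card I + card sold"
    using exists_independent by blast
  then have "indep I" using indep_iff_edge by blast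
  moreover have "y \<le> card I" using I(3) unfolding y_def sold_def by simp
  ultimately show "\<exists>I. indep I \<and> y \<le> card I" by blast
  fix I assume "indep I" and s: "I \<subseteq> {k. inL c d k} \<union> {k. inR c d k}"
  then have "\<not> edge c d i j" if "i \<in> I" "j \<in> I" for i j using indep_iff_edge that by blast
  from card_independent_le[OF s this] show "card I \<le> y" unfolding y_def sold_def by simp
qed

end

lemma sum_upd_Suc:
  fixes p :: "nat \<Rightarrow> nat"
  assumes "j < N" shows "(\<Sum>i<N. (p(j := Suc (p j))) i) = Suc (\<Sum>i<N. p i)"
proof -
  have "(\<Sum>i<N. (p(j := Suc (p j))) i) = (\<Sum>i<N. p i + (if i = j then 1 else 0))"
    by (rule sum.cong) auto
  then show ?thesis using assms by (simp add: sum.distrib)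
qed

section \<open>Correctness of the program\<close>

context encoded_pair
begin

lemma prepared_upd [simp]:
  "x \<noteq> 1 \<Longrightarrow> x \<noteq> 2 \<Longrightarrow> x \<noteq> 4 \<Longrightarrow> prepared (r(x := v), M) \<longleftrightarrow> prepared (r, M)"
  "9 \<le> t \<Longrightarrow> prepared (r, M(t := T)) \<longleftrightarrow> prepared (r, M)"
  by (simp_all add: prepared_def)

lemma prepared_cong:
  assumes "prepared (r, M)" "\<And>x. x < 5 \<Longrightarrow> r' x = r x" "\<And>t. t < 9 \<Longrightarrow> M' t = M t"
  shows "prepared (r', M')"
  using assms(1) unfolding prepared_def by (simp add: assms(2,3))

lemma holds_padj_exp:
  assumes "prepared (r, M)" "r x < n * m" "r y < n * m"
  shows "holds N (padj_exp x y) (r, M) \<longleftrightarrow> padj (r x) (r y)"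
  using assms coords[OF assms(2)] coords[OF assms(3)]
  by (simp add: padj_exp_def prepared_def padj_def)

definition ready :: "nat \<Rightarrow> nat \<Rightarrow> state \<Rightarrow> bool" where
  "ready c d s \<longleftrightarrow> prepared s \<and> (\<forall>k<N. (snd s 10 k \<noteq> 0 \<longleftrightarrow> inL c d k) \<and> (snd s 11 k \<noteq> 0 \<longleftrightarrow> inR c d k))"

text \<open>The loops clear owners and prices only below \<open>N\<close>; by \<open>zero\<close>
  the arrays then vanish everywhere, as the initial auction state requires.\<close>

lemma tables_prog_correct:
  assumes prep: "prepared (r, M)" and cd: "r 5 = c" "r 6 = d"
    and zero: "\<And>j. N \<le> j \<Longrightarrow> M 12 j = 0 \<and> M 13 j = 0"
  shows "\<exists>M'. hrun N tables_prog (r, M) = (r(11 := 0), M') \<and> ready c d (r(11 := 0), M') \<and>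
    M' 12 = (\<lambda>_. 0) \<and> M' 13 = (\<lambda>_. 0)"
proof -
  have r: "r 1 = n" "r (Suc 0) = n" "r 2 = m" "r 4 = n * m" using prep by (auto simp: prepared_def)
  have P: "M 5 (M 7 k) \<noteq> 0 \<longleftrightarrow> core n a (k div m)" and Q: "M 6 (M 8 k) \<noteq> 0 \<longleftrightarrow> core m b (k mod m)"
    and DM: "M 7 k = k div m" "M 8 k = k mod m" if "k < n * m" for k
    using prep coords[OF that] that by (auto simp: prepared_def)
  define r1 where "r1 = r(11 := 0)"
  have r1: "r(11 := 0) = r1" "r1(11 := k) = r(11 := k)" for k by (auto simp: r1_def)
  define T9 where "T9 = (\<lambda>v. if v < N then heval N X_exp (r(11 := v), M) else M 9 v)"
  define M9 where "M9 = M(9 := T9)"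
  have run9: "hrun N (htable 9 11 X_exp) (r, M) = (r1, M9)"
    unfolding r1_def M9_def T9_def by (rule hrun_htable) (simp add: X_exp_def macro_defs)
  have T9: "T9 k \<noteq> 0 \<longleftrightarrow> inX c d k" if "k < N" for k
  proof -
    have "T9 k \<noteq> 0 \<longleftrightarrow> holds N X_exp (r(11 := k), M)" using that by (simp add: T9_def holds_def)
    also have "\<dots> \<longleftrightarrow> inX c d k"
    proof (cases "k < n * m")
      case True
      then show ?thesis using P[OF True] Q[OF True] DM[OF True] by (simp add: X_exp_def r cd inX_def)
    qed (simp add: X_exp_def r inX_def)
    finally show ?thesis .
  qed
  define T10 where "T10 = (\<lambda>v. if v < N then heval N L_exp (r(11 := v), M9) else M9 10 v)"
  define M10 where "M10 = M9(10 := T10)"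
  have run10: "hrun N (htable 10 11 L_exp) (r1, M9) = (r1, M10)"
    unfolding M10_def T10_def
    by (subst hrun_htable) (simp_all add: r1 L_exp_def macro_defs hiff_def padj_exp_def cong: if_cong)
  have prep9: "prepared (r', M9)" if "\<And>x. x < 5 \<Longrightarrow> r' x = r x" for r'
    by (rule prepared_cong[OF prep]) (use that in \<open>auto simp: M9_def\<close>)
  have T10: "T10 k \<noteq> 0 \<longleftrightarrow> inL c d k" if k: "k < N" for k
  proof -
    have "T10 k \<noteq> 0 \<longleftrightarrow> holds N L_exp (r(11 := k), M9)" using that by (simp add: T10_def holds_def)
    also have "\<dots> \<longleftrightarrow> inL c d k"
    proof (cases "k < n * m")
      case True
      have 1: "holds N (padj_exp 12 11) (r(11 := k, 12 := x), M9) \<longleftrightarrow> padj x k" if "x < n * m" for x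
        by (subst holds_padj_exp) (use prep9 that True in auto)
      \<comment> \<open>Bounding \<open>x\<close> by \<open>N\<close> loses nothing, since the trace
        lies below \<open>n * m\<close>.\<close>
      have 2: "(\<forall>x<N. T9 x \<noteq> 0 \<longrightarrow> \<not> holds N (padj_exp 12 11) (r(11 := k, 12 := x), M9)) \<longleftrightarrow>
          (\<forall>x. inX c d x \<longrightarrow> \<not> padj x k)"
      proof -
        have "inX c d x \<Longrightarrow> x < n * m \<and> x < N" for x using N(3) by (auto simp: inX_def)
        then show ?thesis using 1 T9 by metis
      qed
      have "holds N L_exp (r(11 := k), M9) \<longleftrightarrow> T9 k \<noteq> 0 \<or>
          ((M 5 (M 7 k) \<noteq> 0) \<longleftrightarrow> \<not> c < n) \<and> ((M 6 (M 8 k) \<noteq> 0) \<longleftrightarrow> c < n) \<and>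
          (\<forall>x<N. T9 x \<noteq> 0 \<longrightarrow> \<not> holds N (padj_exp 12 11) (r(11 := k, 12 := x), M9))"
        using True by (simp add: L_exp_def r cd M9_def)
      then show ?thesis using True unfolding P[OF True] Q[OF True] 2 T9[OF k] by (simp add: inL_def)
    next
      case False
      then show ?thesis using T9[OF k] by (simp add: L_exp_def r M9_def inL_def)
    qed
    finally show ?thesis .
  qed
  define T11 where "T11 = (\<lambda>v. if v < N then heval N R_exp (r(11 := v), M10) else M10 11 v)"
  define M11 where "M11 = M10(11 := T11)"
  have run11: "hrun N (htable 11 11 R_exp) (r1, M10) = (r1, M11)"
    unfolding M11_def T11_def
    by (subst hrun_htable) (simp_all add: r1 R_exp_def macro_defs cong: if_cong)
  have T11: "T11 k \<noteq> 0 \<longleftrightarrow> inR c d k" if "k < N" for k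
  proof -
    have "T11 k \<noteq> 0 \<longleftrightarrow> holds N R_exp (r(11 := k), M10)" using that by (simp add: T11_def holds_def)
    also have "\<dots> \<longleftrightarrow> inR c d k"
    proof (cases "k < n * m")
      case True
      then show ?thesis using P[OF True] Q[OF True] by (simp add: R_exp_def r cd inR_def M10_def M9_def)
    qed (simp add: R_exp_def r inR_def)
    finally show ?thesis .
  qed
  define M12 where "M12 = M11(12 := (\<lambda>_. 0))"
  define M13 where "M13 = M12(13 := (\<lambda>_. 0))"
  have z: "(\<lambda>v. if v < N then 0 else M11 12 v) = (\<lambda>_. 0)" "(\<lambda>v. if v < N then 0 else M12 13 v) = (\<lambda>_. 0)"
    using zero by (auto simp: M12_def M11_def M10_def M9_def fun_eq_iff)
  have run12: "hrun N (htable 12 11 (HNum 0)) (r1, M11) = (r1, M12)"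
    by (subst hrun_htable) (simp_all add: r1 z M12_def cong: if_cong)
  have run13: "hrun N (htable 13 11 (HNum 0)) (r1, M12) = (r1, M13)"
    by (subst hrun_htable) (simp_all add: r1 z M13_def cong: if_cong)
  have "hrun N tables_prog (r, M) = (r1, M13)"
    unfolding tables_prog_def hrun.simps(3) run9 run10 run11 run12 run13 ..
  moreover have "prepared (r1, M13)"
    by (rule prepared_cong[OF prep]) (auto simp: r1_def M13_def M12_def M11_def M10_def M9_def)
  moreover have "M13 10 = T10" "M13 11 = T11" "M13 12 = (\<lambda>_. 0)" "M13 13 = (\<lambda>_. 0)"
    by (simp_all add: M13_def M12_def M11_def M10_def M9_def)
  ultimately show ?thesis using T10 T11 unfolding r1_def[symmetric] by (auto simp: ready_def)
qed

lemma holds_edge_exp: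
  assumes "ready c d (r, M)" "r x < N" "r y < N"
  shows "holds N (edge_exp x y) (r, M) \<longleftrightarrow> edge c d (r x) (r y)"
proof -
  have p: "prepared (r, M)" and L: "M 10 (r x) \<noteq> 0 \<longleftrightarrow> inL c d (r x)"
    and R: "M 11 (r y) \<noteq> 0 \<longleftrightarrow> inR c d (r y)"
    using assms by (auto simp: ready_def)
  show ?thesis
  proof (cases "inL c d (r x) \<and> inR c d (r y)")
    case True
    then have "holds N (padj_exp x y) (r, M) \<longleftrightarrow> padj (r x) (r y)"
      using holds_padj_exp[OF p] inL_less inR_less by blast
    then show ?thesis using L R by (simp add: edge_exp_def edge_def)
  next
    case False
    then show ?thesis using L R by (auto simp: edge_exp_def edge_def)
  qed
qed

lemma ready_cong:
  assumes "ready c d (r, M)" "\<And>x. x < 5 \<Longrightarrow> r' x = r x" "\<And>t. t < 12 \<Longrightarrow> M' t = M t"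
  shows "ready c d (r', M')"
proof -
  have "prepared (r', M')"
    by (rule prepared_cong[of r M]) (use assms in \<open>auto simp: ready_def\<close>)
  then show ?thesis using assms(1) assms(3)[of 10] assms(3)[of 11] by (simp add: ready_def)
qed

text \<open>Quantifiers up to \<open>N\<close> decide the unbounded ones: neighbours lie below
  \<open>n * m\<close>, and so do owned items, which by the invariant are neighbours of their
  owners.\<close>

lemma holds_bid_exp:
  assumes ready: "ready c d (r, M)" and inv: "auction_inv (edge c d) N (M 12) (M 13)"
    and ij: "r 7 = i" "r 8 = j" "i < N" "j < N"
  shows "holds N bid_exp (r, M) \<longleftrightarrow> bid_allowed (edge c d) N (M 12) (M 13) i j"
proof -
  have 1: "holds N (edge_exp 7 8) (r, M) \<longleftrightarrow> edge c d i j"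
    using holds_edge_exp[OF ready, of 7 8] ij by simp
  have 2: "holds N (edge_exp 7 12) (r(12 := x), M) \<longleftrightarrow> edge c d i x" if "x < N" for x
  proof -
    have "ready c d (r(12 := x), M)" by (rule ready_cong[OF ready]) auto
    from holds_edge_exp[OF this, of 7 12] show ?thesis using ij that by simp
  qed
  have less: "edge c d i x \<Longrightarrow> x < N" for x using edge_less N(3) by force
  have own: "M 12 x = Suc i \<Longrightarrow> edge c d i x" for x using inv by (simp add: auction_inv_def)
  have "holds N bid_exp (r, M) \<longleftrightarrow> edge c d i j \<and> (\<forall>x<N. M 12 x \<noteq> Suc i) \<and> M 13 j < N \<and>
     (\<forall>x<N. holds N (edge_exp 7 12) (r(12 := x), M) \<longrightarrow> M 13 j \<le> M 13 x)"
    unfolding bid_exp_def using 1 ij by simp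
  also have "\<dots> \<longleftrightarrow> edge c d i j \<and> (\<forall>x<N. M 12 x \<noteq> Suc i) \<and> M 13 j < N \<and>
     (\<forall>x<N. edge c d i x \<longrightarrow> M 13 j \<le> M 13 x)"
    using 2 by simp
  also have "\<dots> \<longleftrightarrow> bid_allowed (edge c d) N (M 12) (M 13) i j"
    unfolding bid_allowed_def using less own by blast
  finally show ?thesis .
qed

text \<open>Compares a state of the auction with its starting state \<open>z\<close>; the exempt
  registers are the loop counters.\<close>

definition bidding :: "nat \<Rightarrow> nat \<Rightarrow> state \<Rightarrow> state \<Rightarrow> bool" where
  "bidding c d z s \<longleftrightarrow> (\<forall>x. x \<notin> {7, 8, 9, 10} \<longrightarrow> fst s x = fst z x) \<and>
     (\<forall>t. t \<noteq> 12 \<longrightarrow> t \<noteq> 13 \<longrightarrow> snd s t = snd z t) \<and>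
     auction_inv (edge c d) N (snd s 12) (snd s 13)"

abbreviation allowed :: "nat \<Rightarrow> nat \<Rightarrow> state \<Rightarrow> nat \<Rightarrow> nat \<Rightarrow> bool" where
  "allowed c d s \<equiv> bid_allowed (edge c d) N (snd s 12) (snd s 13)"

abbreviation revenue :: "state \<Rightarrow> nat" where
  "revenue s \<equiv> (\<Sum>j<N. snd s 13 j)"

lemma bidding_upd: "x \<in> {7, 8, 9, 10} \<Longrightarrow> bidding c d z ((fst s)(x := v), snd s) \<longleftrightarrow> bidding c d z s"
proof -
  assume x: "x \<in> {7, 8, 9, 10}"
  then have "((fst s)(x := v)) w = fst s w" if "w \<notin> {7, 8, 9, 10}" for w using that by auto
  then show ?thesis unfolding bidding_def by simp
qed

lemma bidding_ready: "ready c d z \<Longrightarrow> bidding c d z s \<Longrightarrow> ready c d s"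
  using ready_cong[of c d "fst z" "snd z" "fst s" "snd s"] by (simp add: bidding_def)

lemma bid_prog_correct:
  assumes z: "ready c d z" and s: "bidding c d z s" and ij: "fst s 7 = i" "fst s 8 = j" "i < N" "j < N"
  shows "if allowed c d s i j
    then bidding c d z (hrun N bid_prog s) \<and> fst (hrun N bid_prog s) = fst s \<and>
      revenue (hrun N bid_prog s) = Suc (revenue s)
    else hrun N bid_prog s = s"
proof -
  have inv: "auction_inv (edge c d) N (snd s 12) (snd s 13)" using s by (simp add: bidding_def)
  have h: "holds N bid_exp s \<longleftrightarrow> allowed c d s i j"
    using holds_bid_exp[of c d "fst s" "snd s" i j] bidding_ready[OF z s] inv ij by simp
  show ?thesis
  proof (cases "allowed c d s i j")
    case True
    let ?M = "(snd s)(12 := (snd s 12)(j := Suc i), 13 := (snd s 13)(j := Suc (snd s 13 j)))"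
    have run: "hrun N bid_prog s = (fst s, ?M)"
      using h True ij by (simp add: bid_prog_def holds_def)
    have "auction_inv (edge c d) N (?M 12) (?M 13)"
      using auction_inv_bid[OF inv True] by simp
    then have "bidding c d z (fst s, ?M)" using s by (simp add: bidding_def)
    moreover have "revenue (fst s, ?M) = Suc (revenue s)" using sum_upd_Suc[OF ij(4), of "snd s 13"] by simp
    ultimately show ?thesis unfolding run using True by simp
  next
    case False
    then show ?thesis using h by (simp add: bid_prog_def holds_def)
  qed
qed

text \<open>As long as no bid has been made the arrays are unchanged, so a pass over an unstable
  state meets a pair that is still allowed. Bids never lower the revenue.\<close>

lemma pass_prog_correct:
  assumes z: "ready c d z" and s: "bidding c d z s"
  defines "s' \<equiv> hrun N pass_prog s"
  shows "bidding c d z s' \<and>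
    (if auction_stable (edge c d) N (snd s 12) (snd s 13) then snd s' = snd s else revenue s < revenue s')"
proof -
  define ns where "ns \<longleftrightarrow> \<not> auction_stable (edge c d) N (snd s 12) (snd s 13)"
  \<comment> \<open>Either no bid has been made and no pair visited was allowed, or a bid has raised
    the revenue; \<open>ns\<close> rules out the latter for a stable start.\<close>
  define A where "A i t \<longleftrightarrow> bidding c d z t \<and>
    (snd t = snd s \<and> (\<forall>i'<i. \<forall>j'<N. \<not> allowed c d s i' j') \<or> ns \<and> revenue s < revenue t)" for i t
  define B where "B i j t \<longleftrightarrow> bidding c d z t \<and> fst t 7 = i \<and>
    (snd t = snd s \<and> (\<forall>i'<i. \<forall>j'<N. \<not> allowed c d s i' j') \<and> (\<forall>j'<j. \<not> allowed c d s i j') \<or>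
     ns \<and> revenue s < revenue t)" for i j t
  have step: "B i (Suc j) (hrun N bid_prog ((fst t)(8 := j), snd t))"
    if i: "i < N" and j: "j < N" and t: "B i j t" for i j t
  proof -
    define u where "u = ((fst t)(8 := j), snd t)"
    have u: "bidding c d z u" "fst u 7 = i" "fst u 8 = j" "snd u = snd t"
      using t bidding_upd[of 8] by (auto simp: B_def u_def)
    note c = bid_prog_correct[OF z u(1-3) i j]
    show ?thesis
    proof (cases "allowed c d u i j")
      case True
      then have h: "bidding c d z (hrun N bid_prog u)" "fst (hrun N bid_prog u) = fst u"
        "revenue (hrun N bid_prog u) = Suc (revenue u)" using c by auto
      have "revenue s \<le> revenue t" using t by (auto simp: B_def)
      moreover have ns
      proof (cases "snd t = snd s")
        case True
        then have "allowed c d s i j" using \<open>allowed c d u i j\<close> u(4) by simp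
        then show ?thesis unfolding ns_def auction_stable_def by blast
      next
        case False
        then show ?thesis using t by (simp add: B_def)
      qed
      ultimately show ?thesis unfolding u_def[symmetric] using h u by (simp add: B_def)
    next
      case False
      then have h: "hrun N bid_prog u = u" using c by simp
      show ?thesis unfolding u_def[symmetric] h
        using t u False by (auto simp: B_def less_Suc_eq)
    qed
  qed
  have row: "A (Suc i) (hrun N (HFor 8 bid_prog) ((fst t)(7 := i), snd t))"
    if i: "i < N" and t: "A i t" for i t
  proof (rule hrun_ForI[where I = "B i"])
    show "B i 0 ((fst t)(7 := i), snd t)" using t bidding_upd[of 7] by (auto simp: A_def B_def)
  next
    fix u assume "B i N u"
    then show "A (Suc i) ((fst u)(8 := 0), snd u)"
      using bidding_upd[of 8] by (auto simp: A_def B_def less_Suc_eq)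
  qed (use step i in blast)
  have "A N s' \<and> bidding c d z s'"
    unfolding s'_def pass_prog_def
  proof (rule hrun_ForI[where I = A])
    show "A 0 s" using s by (simp add: A_def)
  next
    fix u assume "A N u"
    then show "A N ((fst u)(7 := 0), snd u) \<and> bidding c d z ((fst u)(7 := 0), snd u)"
      using bidding_upd[of 7] by (auto simp: A_def)
  qed (use row in blast)
  moreover have "auction_stable (edge c d) N (snd s 12) (snd s 13)"
    if "\<forall>i'<N. \<forall>j'<N. \<not> allowed c d s i' j'"
    unfolding auction_stable_def
  proof (intro allI notI)
    fix i j assume al: "allowed c d s i j"
    then have "edge c d i j" by (simp add: bid_allowed_def)
    then have "i < N" "j < N" using edge_less N(3) by force+
    then show False using that al by blast
  qed
  ultimately show ?thesis unfolding A_def ns_def by auto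
qed

text \<open>Sold items are endpoints of edges, so fewer than \<open>N\<close> indices have a
  positive price, and no price exceeds \<open>N\<close>.\<close>

lemma revenue_bound:
  assumes "bidding c d z s" shows "revenue s < N * N"
proof -
  have inv: "auction_inv (edge c d) N (snd s 12) (snd s 13)" using assms by (simp add: bidding_def)
  have zero: "snd s 13 j = 0" if "n * m \<le> j" for j
  proof (cases "snd s 12 j")
    case 0
    then show ?thesis using inv by (simp add: auction_inv_def)
  next
    case (Suc i)
    then have "edge c d i j" using inv by (simp add: auction_inv_def)
    then show ?thesis using edge_less that by force
  qed
  have "revenue s = (\<Sum>j<n * m. snd s 13 j)"
    by (rule sum.mono_neutral_right) (use zero N(3) in auto)
  also have "\<dots> \<le> of_nat (card {..<n * m}) * N"
    by (rule sum_bounded_above) (use inv in \<open>simp add: auction_inv_def\<close>)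
  also have "\<dots> < N * N" using N by simp
  finally show ?thesis .
qed

lemma auction_prog_correct:
  assumes z: "ready c d z" and s: "bidding c d z s"
  defines "s' \<equiv> hrun N auction_prog s"
  shows "bidding c d z s' \<and> auction_stable (edge c d) N (snd s' 12) (snd s' 13)"
proof -
  \<comment> \<open>After \<open>k\<close> passes the auction is stable or has earned at least
    \<open>k\<close>. For \<open>k = N * N\<close> the bound on the revenue leaves only
    stability.\<close>
  define A where "A k t \<longleftrightarrow> bidding c d z t \<and>
    (auction_stable (edge c d) N (snd t 12) (snd t 13) \<or> k \<le> revenue t)" for k t
  have upd: "A k ((fst t)(x := v), snd t) \<longleftrightarrow> A k t" if "x \<in> {9, 10}" for k x v t
    using that bidding_upd[of x] by (auto simp: A_def)
  have step: "A (Suc k) (hrun N pass_prog t)" if "A k t" for k t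
    using that pass_prog_correct[OF z, of t] by (auto simp: A_def split: if_splits)
  have inner: "A (l * N + N) (hrun N (HFor 10 pass_prog) t)" if "A (l * N) t" for l t
    by (rule hrun_ForI[where I = "\<lambda>b. A (l * N + b)"]) (use that step upd in auto)
  have "A (N * N) s'"
    unfolding s'_def auction_prog_def
  proof (rule hrun_ForI[where I = "\<lambda>l. A (l * N)"])
    show "A (0 * N) s" using s by (simp add: A_def)
  next
    fix l t assume "A (l * N) t"
    then have "A (l * N) ((fst t)(9 := l), snd t)" using upd by simp
    from inner[OF this] show "A (Suc l * N) (hrun N (HFor 10 pass_prog) ((fst t)(9 := l), snd t))"
      by (simp add: add.commute)
  qed (use upd in auto)
  then show ?thesis using revenue_bound[of c d z s'] by (auto simp: A_def)
qed

text \<open>The zero entries from \<open>N\<close> on are handed to the next round, which again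
  clears only \<open>N\<close> entries.\<close>

lemma round_prog_correct:
  assumes prep: "prepared (r, M)" and cd: "r 5 = c" "r 6 = d"
    and zero: "\<And>j. N \<le> j \<Longrightarrow> M 12 j = 0 \<and> M 13 j = 0"
  obtains r' M' y where "hrun N round_prog (r, M) = (r', M')" "prepared (r', M')" "r' 5 = c" "r' 6 = d"
    "\<forall>j\<ge>N. M' 12 j = 0 \<and> M' 13 j = 0" "r' 0 = max (r 0) y" "\<exists>I. indep I \<and> y \<le> card I"
    "\<forall>I. indep I \<longrightarrow> I \<subseteq> {k. inL c d k} \<union> {k. inR c d k} \<longrightarrow> card I \<le> y"
proof -
  obtain M1 where M1: "hrun N tables_prog (r, M) = (r(11 := 0), M1)" "ready c d (r(11 := 0), M1)"
    "M1 12 = (\<lambda>_. 0)" "M1 13 = (\<lambda>_. 0)"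
    using tables_prog_correct[OF assms] by auto
  define z where "z = (r(11 := 0), M1)"
  have "bidding c d z z" by (simp add: bidding_def z_def M1 auction_inv_init)
  then have s: "bidding c d z (hrun N auction_prog z)"
    "auction_stable (edge c d) N (snd (hrun N auction_prog z) 12) (snd (hrun N auction_prog z) 13)"
    using auction_prog_correct[of c d z z] M1(2) by (simp_all add: z_def)
  obtain r2 M2 where s2: "hrun N auction_prog z = (r2, M2)" by force
  have ready: "ready c d (r2, M2)" using bidding_ready[OF M1(2)[folded z_def] s(1)] unfolding s2 .
  have inv: "auction_inv (edge c d) N (M2 12) (M2 13)" using s(1) by (simp add: bidding_def s2)
  have st: "auction_stable (edge c d) N (M2 12) (M2 13)" using s(2) by (simp add: s2)
  have r2: "r2 5 = c" "r2 6 = d" "r2 0 = r 0" using s(1)[unfolded s2] cd by (simp_all add: bidding_def z_def)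
  have zero2: "M2 12 j = 0 \<and> M2 13 j = 0" if "N \<le> j" for j
  proof (cases "M2 12 j")
    case 0
    then show ?thesis using inv by (simp add: auction_inv_def)
  next
    case (Suc i)
    then have "edge c d i j" using inv by (simp add: auction_inv_def)
    then show ?thesis using edge_less N(3) that by force
  qed
  define y where "y = card {k. inL c d k} + card {k. inR c d k} - card {j. 0 < M2 13 j}"
  have LN: "inL c d k \<Longrightarrow> k < N" and RN: "inR c d k \<Longrightarrow> k < N" for k
    using inL_less inR_less N(3) by force+
  have sets: "{k. k < N \<and> M2 10 k \<noteq> 0} = {k. inL c d k}" "{k. k < N \<and> M2 11 k \<noteq> 0} = {k. inR c d k}"
    "{k. k < N \<and> M2 13 k \<noteq> 0} = {j. 0 < M2 13 j}"
    using ready LN RN zero2 by (auto simp: ready_def not_less) (metis not_less not_less_zero)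
  have "heval N value_exp (r2, M2) = card {k. k < N \<and> M2 10 k \<noteq> 0} + card {k. k < N \<and> M2 11 k \<noteq> 0}
     - card {k. k < N \<and> M2 13 k \<noteq> 0}"
    by (simp add: value_exp_def)
  then have y: "heval N value_exp (r2, M2) = y" unfolding sets y_def .
  have run: "hrun N round_prog (r, M) = (r2(0 := max (r 0) y), M2)"
    using M1(1) s2 r2 y by (simp add: round_prog_def z_def max_def cong: if_cong)
  show thesis
  proof (rule that[OF run])
    show "prepared (r2(0 := max (r 0) y), M2)" using ready by (simp add: ready_def)
    show "\<exists>I. indep I \<and> y \<le> card I" unfolding y_def by (rule stable_value(1)[OF N(3) inv st])
    show "\<forall>I. indep I \<longrightarrow> I \<subseteq> {k. inL c d k} \<union> {k. inR c d k} \<longrightarrow> card I \<le> y"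
      unfolding y_def using stable_value(2)[OF N(3) inv st] by blast
  qed (use r2 zero2 in auto)
qed

lemma main_prog_correct:
  fixes r :: "nat \<Rightarrow> nat" and M :: "nat \<Rightarrow> nat \<Rightarrow> nat"
  assumes "M 0 = f" and zero: "\<And>j. M 12 j = 0 \<and> M 13 j = 0"
  defines "y \<equiv> fst (hrun N main_prog (r, M)) 0"
  shows "\<exists>I. indep I \<and> card I = y" "\<And>I. indep I \<Longrightarrow> card I \<le> y"
proof -
  obtain r1 M1 where 1: "hrun N prep_prog (r, M) = (r1, M1)" "prepared (r1, M1)" "\<forall>t\<ge>9. M1 t = M t"
    using prep_prog_correct[where M = M and r = r, OF assms(1)] by blast
  define covers where "covers y c d \<longleftrightarrow>
    (\<forall>I. indep I \<longrightarrow> I \<subseteq> {k. inL c d k} \<union> {k. inR c d k} \<longrightarrow> card I \<le> y)" for y c d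
  have covers_mono: "covers y c d \<Longrightarrow> y \<le> y' \<Longrightarrow> covers y' c d" for y y' c d
    unfolding covers_def by (meson le_trans)
  \<comment> \<open>The invariant has two halves: some independent set is at least as large as
    register 0, and \<open>covers\<close> records that register 0 bounds all sets belonging to the
    pairs already treated.\<close>
  define Z where "Z s \<longleftrightarrow> prepared s \<and> (\<forall>j\<ge>N. snd s 12 j = 0 \<and> snd s 13 j = 0) \<and>
    (\<exists>I. indep I \<and> fst s 0 \<le> card I)" for s
  define A where "A c s \<longleftrightarrow> Z s \<and> (\<forall>c'<c. \<forall>d'<N. covers (fst s 0) c' d')" for c s
  define B where "B c d s \<longleftrightarrow> A c s \<and> fst s 5 = c \<and> (\<forall>d'<d. covers (fst s 0) c d')" for c d s
  have Z_upd: "Z ((fst s)(x := v), snd s) \<longleftrightarrow> Z s" if "x \<in> {5, 6}" for x v s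
    using that prepared_upd(1)[of x "fst s" v "snd s"] by (auto simp: Z_def)
  have A_upd: "A c ((fst s)(x := v), snd s) \<longleftrightarrow> A c s" if "x \<in> {5, 6}" for x v s c
    using that Z_upd[of x] by (auto simp: A_def)
  have step: "B c (Suc d) (hrun N round_prog ((fst s)(6 := d), snd s))" if "B c d s" for c d s
  proof -
    define r2 where "r2 = (fst s)(6 := d)"
    have A2: "A c (r2, snd s)" and r2: "r2 5 = c" "r2 6 = d" "r2 0 = fst s 0"
      and cov: "\<forall>d'<d. covers (r2 0) c d'"
      using that A_upd[of 6] by (auto simp: B_def r2_def)
    have p: "prepared (r2, snd s)" and z: "\<And>j. N \<le> j \<Longrightarrow> snd s 12 j = 0 \<and> snd s 13 j = 0"
      and ex: "\<exists>I. indep I \<and> r2 0 \<le> card I" and covA: "\<forall>c'<c. \<forall>d'<N. covers (r2 0) c' d'"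
      using A2 by (auto simp: A_def Z_def)
    obtain y r3 M3 where 3: "hrun N round_prog (r2, snd s) = (r3, M3)" "prepared (r3, M3)" "r3 5 = c"
      "r3 6 = d" "\<forall>j\<ge>N. M3 12 j = 0 \<and> M3 13 j = 0" "r3 0 = max (r2 0) y"
      "\<exists>I. indep I \<and> y \<le> card I"
      "\<forall>I. indep I \<longrightarrow> I \<subseteq> {k. inL c d k} \<union> {k. inR c d k} \<longrightarrow> card I \<le> y"
      by (rule round_prog_correct[OF p r2(1,2) z])
    have le: "r2 0 \<le> r3 0" "y \<le> r3 0" using 3(6) by auto
    have "covers y c d" using 3(8) by (simp add: covers_def)
    then have "covers (r3 0) c d'" if "d' < Suc d" for d'
      using that cov covers_mono le by (auto simp: less_Suc_eq)
    moreover have "\<exists>I. indep I \<and> r3 0 \<le> card I" using ex 3(6,7) by (cases "r2 0 \<le> y") (auto simp: max_def)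
    moreover have "\<forall>c'<c. \<forall>d'<N. covers (r3 0) c' d'" using covA covers_mono le by blast
    ultimately show ?thesis
      unfolding r2_def[symmetric] 3(1) using 3(2,3,5) by (auto simp: B_def A_def Z_def)
  qed
  have row: "A (Suc c) (hrun N (HFor 6 round_prog) ((fst s)(5 := c), snd s))" if "A c s" for c s
  proof (rule hrun_ForI[where I = "B c"])
    show "B c 0 ((fst s)(5 := c), snd s)" using that A_upd[of 5] by (auto simp: B_def)
  next
    fix t assume "B c N t"
    then have "A (Suc c) t" by (auto simp: A_def B_def less_Suc_eq)
    then show "A (Suc c) ((fst t)(6 := 0), snd t)" using A_upd by simp
  qed (use step in blast)
  have "indep {}" by (simp add: indep_def)
  then have init: "A 0 (r1(0 := 0), M1)"
    using 1(2,3) zero by (auto simp: A_def Z_def)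
  have "A N (hrun N (HFor 5 (HFor 6 round_prog)) (r1(0 := 0), M1))"
    by (rule hrun_ForI[where I = A]) (use init row A_upd in auto)
  moreover have "hrun N main_prog (r, M) = hrun N (HFor 5 (HFor 6 round_prog)) (r1(0 := 0), M1)"
    unfolding main_prog_def hrun.simps(1,3) 1(1) by simp
  ultimately have A: "A N (hrun N main_prog (r, M))" by simp
  show le: "card I \<le> y" if I: "indep I" for I
  proof -
    \<comment> \<open>As \<open>c \<le> n < N\<close> and \<open>d \<le> m < N\<close>, the loops
      have treated this pair.\<close>
    obtain c d where cd: "c \<le> n" "d \<le> m" "I \<subseteq> {k. inL c d k \<or> inR c d k}" using indep_covered[OF I] by blast
    have "covers y c d" using A cd N by (auto simp: A_def y_def)
    moreover have "I \<subseteq> {k. inL c d k} \<union> {k. inR c d k}" using cd(3) by blast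
    ultimately show ?thesis using I unfolding covers_def by blast
  qed
  obtain I where "indep I" "y \<le> card I" using A by (auto simp: A_def Z_def y_def)
  then show "\<exists>I. indep I \<and> card I = y" using le by (meson le_antisym)
qed

end

section \<open>Decoding the input\<close>

lemma nth_concat_uniform:
  assumes "\<forall>l\<in>set xss. length l = n" "i < length xss" "j < n"
  shows "concat xss ! (i * n + j) = xss ! i ! j"
  using assms
proof (induction xss arbitrary: i)
  case (Cons xs xss)
  then show ?case
  proof (cases i)
    case (Suc i')
    have "concat (xs # xss) ! (i * n + j) = concat xss ! (i' * n + j)"
      using Cons.prems Suc by (simp add: nth_append)
    then show ?thesis using Cons Suc by simp
  qed (simp add: nth_append)
qed simp

lemma length_concat_uniform:
  "\<forall>l\<in>set xss. length l = n \<Longrightarrow> length (concat xss) = length xss * n"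
  by (induction xss) auto

lemma length_encode_graph:
  "length (encode_graph G vs) = 1 + length vs + length vs * length vs"
  using length_concat_uniform[of "map (\<lambda>u. map (\<lambda>v. (u, v) \<in> parcs G) vs) vs" "length vs"]
  by (simp add: encode_graph_def)

lemma nth_encode_graph:
  "y < length vs \<Longrightarrow> encode_graph G vs ! y"
  "\<not> encode_graph G vs ! length vs"
  "i < length vs \<Longrightarrow> j < length vs \<Longrightarrow>
    encode_graph G vs ! (1 + length vs + i * length vs + j) \<longleftrightarrow> (vs ! i, vs ! j) \<in> parcs G"
proof -
  show "y < length vs \<Longrightarrow> encode_graph G vs ! y" by (simp add: encode_graph_def nth_append)
  show "\<not> encode_graph G vs ! length vs" by (simp add: encode_graph_def nth_append)
  assume ij: "i < length vs" "j < length vs"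
  let ?n = "length vs" and ?m = "concat (map (\<lambda>u. map (\<lambda>v. (u, v) \<in> parcs G) vs) vs)"
  have "encode_graph G vs ! (1 + ?n + i * ?n + j) = ?m ! (i * ?n + j)"
    by (simp add: encode_graph_def nth_append)
  also have "\<dots> \<longleftrightarrow> (vs ! i, vs ! j) \<in> parcs G"
    using nth_concat_uniform[of "map (\<lambda>u. map (\<lambda>v. (u, v) \<in> parcs G) vs) vs" ?n i j] ij by simp
  finally show "encode_graph G vs ! (1 + ?n + i * ?n + j) \<longleftrightarrow> (vs ! i, vs ! j) \<in> parcs G" .
qed

text \<open>The partition given by the split property enters only the proof, as the index set
  \<open>C0\<close>; the program works with \<open>core\<close>, computed from the degrees.\<close>

lemma split_graph_listing:
  fixes G :: "nat pair_pre_digraph"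
  assumes G: "split_graph G" and vs: "vertex_listing G vs"
  defines "n \<equiv> length vs" and "a \<equiv> \<lambda>i j. (vs ! i, vs ! j) \<in> parcs G"
  shows "\<And>u v. u < n \<Longrightarrow> v < n \<Longrightarrow> a u v \<Longrightarrow> a v u" and "\<And>u. u < n \<Longrightarrow> \<not> a u u"
    and "\<And>u v. u < n \<Longrightarrow> v < n \<Longrightarrow> \<not> core n a u \<Longrightarrow> \<not> core n a v \<Longrightarrow> \<not> a u v"
proof -
  interpret pair_graph G using G by (simp add: split_graph_def)
  show sym: "a v u" if "u < n" "v < n" "a u v" for u v
    using that arcs_symmetric unfolding a_def by blast
  show irr: "\<not> a u u" if "u < n" for u
    using no_loops'[of "vs ! u" "vs ! u"] unfolding a_def by blast
  obtain S C where SC: "S \<union> C = pverts G" "S \<inter> C = {}" "clique G C" "independent_set G S"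
    using G by (auto simp: split_graph_def)
  define C0 where "C0 = {i. i < n \<and> vs ! i \<in> C}"
  have dist: "distinct vs" and set: "set vs = pverts G" using vs by (auto simp: vertex_listing_def)
  have inj: "vs ! i \<noteq> vs ! j" if "i < n" "j < n" "i \<noteq> j" for i j
    using that nth_eq_iff_index_eq[OF dist, of i j] by (simp add: n_def)
  have mem: "vs ! i \<in> pverts G" if "i < n" for i
    using that nth_mem[of i vs] by (simp add: n_def set)
  show "\<not> a u v" if "u < n" "v < n" "\<not> core n a u" "\<not> core n a v" for u v
  proof (rule not_core_independent[of n a C0])
    show "\<forall>u\<in>C0. \<forall>v\<in>C0. u \<noteq> v \<longrightarrow> a u v"
      using SC(3) inj unfolding C0_def clique_def a_def by blast
    show "\<forall>u\<in>{..<n} - C0. \<forall>v\<in>{..<n} - C0. \<not> a u v"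
    proof (intro ballI)
      fix u v assume "u \<in> {..<n} - C0" "v \<in> {..<n} - C0"
      then have "vs ! u \<in> S" "vs ! v \<in> S" using mem[of u] mem[of v] SC(1) by (auto simp: C0_def)
      then show "\<not> a u v" using SC(4) by (simp add: independent_set_def a_def)
    qed
  qed (use that sym irr in \<open>auto simp: C0_def\<close>)
qed

lemma encoded_pair_of_graphs:
  fixes G H :: "nat pair_pre_digraph"
  assumes G: "split_graph G" "vertex_listing G vs" and H: "split_graph H" "vertex_listing H ws"
  defines "w \<equiv> encode_graph G vs @ encode_graph H ws"
  shows "encoded_pair (length vs) (length ws) (\<lambda>i j. (vs ! i, vs ! j) \<in> parcs G)
    (\<lambda>i j. (ws ! i, ws ! j) \<in> parcs H) (\<lambda>i. if i < length w \<and> w ! i then 1 else 0) (length w)"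
proof -
  let ?n = "length vs" and ?m = "length ws"
  let ?a = "\<lambda>i j. (vs ! i, vs ! j) \<in> parcs G" and ?b = "\<lambda>i j. (ws ! i, ws ! j) \<in> parcs H"
  note g = split_graph_listing[OF G] and h = split_graph_listing[OF H]
  have len: "length w = 1 + ?n + ?n * ?n + (1 + ?m + ?m * ?m)"
    by (simp add: w_def length_encode_graph)
  have w1: "w ! i = encode_graph G vs ! i" if "i < 1 + ?n + ?n * ?n" for i
    using that by (simp add: w_def nth_append length_encode_graph)
  have w2: "w ! (1 + ?n + ?n * ?n + i) = encode_graph H ws ! i" for i
    by (simp add: w_def nth_append length_encode_graph)
  have idx: "i * k + j < k * k" if "i < k" "j < k" for i j k :: nat
  proof -
    have "i * k + j < Suc i * k" using that by simp
    also have "\<dots> \<le> k * k" using that by (intro mult_le_mono1) simp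
    finally show ?thesis .
  qed
  show ?thesis
  proof
    fix u v assume "u < ?n" "v < ?n" "core ?n ?a u" "core ?n ?a v" "u \<noteq> v"
    then show "?a u v" using core_clique[of ?n ?a u v] g(1) by blast
  next
    fix u v assume "u < ?m" "v < ?m" "core ?m ?b u" "core ?m ?b v" "u \<noteq> v"
    then show "?b u v" using core_clique[of ?m ?b u v] h(1) by blast
  next
    \<comment> \<open>The product is at most the larger of the two squares, and both squares are
      summands of the length.\<close>
    show "?n * ?m < length w"
    proof (cases "?n \<le> ?m")
      case True
      then have "?n * ?m \<le> ?m * ?m" by simp
      then show ?thesis unfolding len by linarith
    next
      case False
      then have "?n * ?m \<le> ?n * ?n" by simp
      then show ?thesis unfolding len by linarith
    qed
  next
    fix i j assume ij: "i < ?n" "j < ?n"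
    then show "((if 1 + ?n + i * ?n + j < length w \<and> w ! (1 + ?n + i * ?n + j) then 1 else 0) \<noteq> (0::nat)) \<longleftrightarrow> ?a i j"
      using idx[OF ij] w1[of "1 + ?n + i * ?n + j"] nth_encode_graph(3)[OF ij, of G]
      unfolding len by simp
  next
    fix i j assume ij: "i < ?m" "j < ?m"
    let ?k = "1 + ?n + ?n * ?n + (1 + ?m) + i * ?m + j"
    have "w ! ?k \<longleftrightarrow> ?b i j"
      using w2[of "1 + ?m + i * ?m + j"] nth_encode_graph(3)[OF ij, of H] by (simp add: add.assoc)
    then show "((if ?k < length w \<and> w ! ?k then 1 else 0) \<noteq> (0::nat)) \<longleftrightarrow> ?b i j"
      using idx[OF ij] unfolding len by simp
  next
    fix y assume "y < ?m"
    then show "(if 1 + ?n + ?n * ?n + y < length w \<and> w ! (1 + ?n + ?n * ?n + y) then 1 else 0) \<noteq> (0::nat)"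
      using w2[of y] nth_encode_graph(1)[of y ws H] unfolding len by simp
  next
    show "(if 1 + ?n + ?n * ?n + ?m < length w \<and> w ! (1 + ?n + ?n * ?n + ?m) then 1 else 0) = (0::nat)"
      using w2[of ?m] nth_encode_graph(2)[of H ws] by simp
  next
    fix y assume "y < ?n"
    then show "(if y < length w \<and> w ! y then 1 else 0) \<noteq> (0::nat)"
      using w1[of y] nth_encode_graph(1)[of y vs G] unfolding len by simp
  next
    show "(if ?n < length w \<and> w ! ?n then 1 else 0) = (0::nat)"
      using w1[of ?n] nth_encode_graph(2)[of G vs] by simp
  next
    show "?n < length w" "?m < length w" unfolding len by simp_all
  qed (use g h in \<open>blast+\<close>)
qed

lemma independence_number_eqI:
  assumes "\<exists>I. independent_set G I \<and> card I = y"
    "\<And>I. independent_set G I \<Longrightarrow> card I \<le> y"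
  shows "independence_number G = y"
proof -
  have "{card I | I. independent_set G I} \<subseteq> {..y}" using assms(2) by auto
  then have "finite {card I | I. independent_set G I}" by (rule finite_subset) simp
  then show ?thesis
    unfolding independence_number_def by (intro Max_eqI) (use assms in auto)
qed

lemma independence_number_tensor_product:
  fixes G H :: "nat pair_pre_digraph"
  assumes G: "split_graph G" "vertex_listing G vs" and H: "split_graph H" "vertex_listing H ws"
  defines "w \<equiv> encode_graph G vs @ encode_graph H ws"
  shows "fst (hrun (length w) main_prog (init_state w)) 0 = independence_number (tensor_product G H)"
proof -
  define n m where "n = length vs" and "m = length ws"
  define a b where "a = (\<lambda>i j. (vs ! i, vs ! j) \<in> parcs G)" and "b = (\<lambda>i j. (ws ! i, ws ! j) \<in> parcs H)"
  interpret encoded_pair n m a b "\<lambda>i. if i < length w \<and> w ! i then 1 else 0" "length w"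
    using encoded_pair_of_graphs[OF G H] unfolding w_def n_def m_def a_def b_def .
  define y where "y = fst (hrun (length w) main_prog (init_state w)) 0"
  have y: "\<exists>I. indep I \<and> card I = y" "indep I \<Longrightarrow> card I \<le> y" for I
    unfolding y_def init_state_def by (rule main_prog_correct; simp)+
  \<comment> \<open>Decoding is an isomorphism from \<open>padj\<close> on \<open>{..<n * m}\<close>
    to the tensor product, so independent sets correspond with their sizes.\<close>
  define \<phi> where "\<phi> k = (vs ! (k div m), ws ! (k mod m))" for k
  have dist: "distinct vs" "distinct ws" "set vs = pverts G" "set ws = pverts H"
    using G(2) H(2) by (auto simp: vertex_listing_def)
  have inj: "inj_on \<phi> {..<n * m}"
  proof (rule inj_onI)
    fix u v assume "u \<in> {..<n * m}" "v \<in> {..<n * m}" and eq: "\<phi> u = \<phi> v"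
    then have "u div m < n" "u mod m < m" "v div m < n" "v mod m < m" using coords by auto
    then have "u div m = v div m" "u mod m = v mod m"
      using eq nth_eq_iff_index_eq[OF dist(1), of "u div m" "v div m"]
        nth_eq_iff_index_eq[OF dist(2), of "u mod m" "v mod m"]
      by (simp_all add: \<phi>_def n_def[symmetric] m_def[symmetric])
    then show "u = v" by (rule coords_inj)
  qed
  have img: "\<phi> ` {..<n * m} = pverts G \<times> pverts H"
  proof (intro equalityI subsetI)
    fix x assume "x \<in> \<phi> ` {..<n * m}"
    then obtain k where k: "k < n * m" "x = \<phi> k" by auto
    then show "x \<in> pverts G \<times> pverts H"
      using coords[OF k(1)] dist(3,4) by (auto simp: \<phi>_def n_def m_def)
  next
    fix x assume "x \<in> pverts G \<times> pverts H"
    then have "fst x \<in> set vs" "snd x \<in> set ws" using dist by auto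
    then obtain i j where ij: "i < n" "j < m" "fst x = vs ! i" "snd x = ws ! j"
      by (metis in_set_conv_nth n_def m_def)
    have "i * m + j < Suc i * m" using ij by simp
    also have "\<dots> \<le> n * m" using ij by (intro mult_le_mono1) simp
    finally have "i * m + j < n * m" .
    moreover have "\<phi> (i * m + j) = x" using ij by (simp add: \<phi>_def prod_eq_iff)
    ultimately show "x \<in> \<phi> ` {..<n * m}" by force
  qed
  have arc: "(\<phi> u, \<phi> v) \<in> parcs (tensor_product G H) \<longleftrightarrow> padj u v" for u v
    unfolding padj_def by (simp add: tensor_product_def \<phi>_def a_def b_def)
  have ind: "independent_set (tensor_product G H) (\<phi> ` I) \<longleftrightarrow> indep I" if "I \<subseteq> {..<n * m}" for I
  proof -
    have "\<phi> ` I \<subseteq> pverts (tensor_product G H)"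
      using that img by (auto simp: tensor_product_def)
    then show ?thesis using that by (simp add: independent_set_def indep_def arc)
  qed
  have card: "card (\<phi> ` I) = card I" if "I \<subseteq> {..<n * m}" for I
    using inj that by (meson card_image inj_on_subset)
  have sub: "I \<subseteq> {..<n * m}" if "indep I" for I using that by (simp add: indep_def)
  have "independence_number (tensor_product G H) = y"
  proof (rule independence_number_eqI)
    obtain I where "indep I" "card I = y" using y(1) by blast
    then show "\<exists>I. independent_set (tensor_product G H) I \<and> card I = y"
      using ind card sub by blast
  next
    fix J assume J: "independent_set (tensor_product G H) J"
    then have "J \<subseteq> \<phi> ` {..<n * m}" unfolding img by (simp add: independent_set_def tensor_product_def)
    then obtain I where I: "I \<subseteq> {..<n * m}" "J = \<phi> ` I" by (meson subset_imageE)
    then show "card J \<le> y" using J ind card y(2) by auto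
  qed
  then show ?thesis by (simp add: y_def)
qed

text \<open>The program mentions registers up to 13, so register 15 is free for the loop
  bound.\<close>

lemma cregs_below_main_prog: "cregs_below 15 main_prog"
  by (simp add: main_prog_def prep_prog_def round_prog_def tables_prog_def auction_prog_def pass_prog_def
      bid_prog_def bid_exp_def edge_exp_def padj_exp_def X_exp_def L_exp_def R_exp_def value_exp_def
      run_length_def row_table_def deg_table_def core_table_def htable_def hiff_def macro_defs)

theorem theorem2:
  shows "poly_time_computable
    {(G :: nat pair_pre_digraph, vs, H :: nat pair_pre_digraph, ws).
       split_graph G \<and> vertex_listing G vs \<and> split_graph H \<and> vertex_listing H ws}
    (\<lambda>(G, vs, H, ws). encode_graph G vs @ encode_graph H ws)
    (\<lambda>(G, vs, H, ws). independence_number (tensor_product G H))"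
proof (rule poly_time_computableI[OF cregs_below_main_prog], simp, clarsimp simp del: length_append)
  fix G H :: "nat pair_pre_digraph" and vs ws
  assume "split_graph G" "vertex_listing G vs" "split_graph H" "vertex_listing H ws"
  then show "fst (hrun (length (encode_graph G vs @ encode_graph H ws)) main_prog
      (init_state (encode_graph G vs @ encode_graph H ws))) 0 = independence_number (tensor_product G H)"
    by (rule independence_number_tensor_product)
qed

end
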